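(* For every positive integer $w$, the class of (finite) graphs of treewidth at most $w$ has asymptotic dimension at most $1$.
   Context: All graphs are finite and simple. A graph $G$ is regarded as the metric space $(V(G),d_G)$, where $d_G(x,y)$ is the number of edges of a shortest path between $x$ and $y$ ($\infty$ if there is none). For a (pseudo)metric space $(X,d)$, a family $\mathcal U$ of subsets of $X$ is $D$-bounded if each member has diameter at most $D$, and $r$-disjoint if $d(a,b)>r$ whenever $a,b$ lie in different members. A function $D_X:\mathbb{R}^+\to\mathbb{R}^+$ is an $n$-dimensional control function for $(X,d)$ if for every $r>0$ there is a cover $\mathcal U=\bigcup_{i=1}^{n+1}\mathcal U_i$ of $X$ such that each $\mathcal U_i$ is $r$-disjoint and each member of $\mathcal U$ is $D_X(r)$-bounded. The asymptotic dimension of a family of (pseudo)metric spaces is the least integer $n$ for which there exists a single function that is an $n$-dimensional control function for every member of the family. Treewidth has its standard meaning (minimum over tree-decompositions of the maximum bag size minus one). *)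

theory Defs
  imports "Graph_Theory.Graph_Theory" "HOL-Library.Extended_Nat"
begin

text \<open>
  Finite simple graphs are the symmetric, loop-free finite digraphs without parallel arcs of
  \<^locale>\<open>pair_graph\<close>: an edge between \<open>u\<close> and \<open>v\<close> is the pair of arcs \<open>(u, v)\<close>, \<open>(v, u)\<close>.
\<close>

subsection \<open>The metric of a graph\<close>

text \<open>With unit weights the cost of a walk is its number of edges; the infimum over
  the empty set is \<open>\<infinity>\<close>, so vertices in different components are at distance \<open>\<infinity>\<close>.\<close>

definition graph_dist :: "'a pair_pre_digraph \<Rightarrow> 'a \<Rightarrow> 'a \<Rightarrow> ereal" where
  "graph_dist G u v = wf_digraph.\<mu> (with_proj G) (\<lambda>_. 1) u v"

subsection \<open>Asymptotic dimension\<close>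

text \<open>A (pseudo)metric space, infinite distances allowed, is given by its set of points and its
  distance function. In \<^typ>\<open>ereal\<close> the empty set gets diameter \<open>-\<infinity>\<close>, so it is \<open>D\<close>-bounded
  for every \<open>D\<close>.\<close>

definition ext_diameter :: "('a \<Rightarrow> 'a \<Rightarrow> ereal) \<Rightarrow> 'a set \<Rightarrow> ereal" where
  "ext_diameter d A = (SUP x\<in>A. SUP y\<in>A. d x y)"

definition bounded_family :: "('a \<Rightarrow> 'a \<Rightarrow> ereal) \<Rightarrow> real \<Rightarrow> 'a set set \<Rightarrow> bool" where
  "bounded_family d D \<U> \<longleftrightarrow> (\<forall>A\<in>\<U>. ext_diameter d A \<le> ereal D)"

definition disjoint_family_at_scale :: "('a \<Rightarrow> 'a \<Rightarrow> ereal) \<Rightarrow> real \<Rightarrow> 'a set set \<Rightarrow> bool" where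
  "disjoint_family_at_scale d r \<U> \<longleftrightarrow>
     (\<forall>A\<in>\<U>. \<forall>B\<in>\<U>. A \<noteq> B \<longrightarrow> (\<forall>a\<in>A. \<forall>b\<in>B. d a b > ereal r))"

definition control_function ::
    "nat \<Rightarrow> (real \<Rightarrow> real) \<Rightarrow> 'a set \<Rightarrow> ('a \<Rightarrow> 'a \<Rightarrow> ereal) \<Rightarrow> bool" where
  "control_function n D X d \<longleftrightarrow>
     (\<forall>r>0. D r > 0) \<and>
     (\<forall>r>0. \<exists>\<U> :: nat \<Rightarrow> 'a set set.
        \<Union>(\<Union>i\<in>{1..n+1}. \<U> i) = X \<and>
        (\<forall>i\<in>{1..n+1}. disjoint_family_at_scale d r (\<U> i)) \<and>
        bounded_family d (D r) (\<Union>i\<in>{1..n+1}. \<U> i))"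

text \<open>The value is \<open>\<infinity>\<close> (the infimum of the empty set) if there is no such \<open>n\<close>.\<close>

definition asdim :: "('a set \<times> ('a \<Rightarrow> 'a \<Rightarrow> ereal)) set \<Rightarrow> enat" where
  "asdim \<F> = Inf {enat n | n. \<exists>D. \<forall>(X, d)\<in>\<F>. control_function n D X d}"

subsection \<open>Treewidth\<close>

text \<open>\<^const>\<open>Digraph_Component.tree\<close> forbids all directed cycles, hence also the
  2-cycle formed by the two arcs of an edge. A cycle of an undirected graph is a directed
  cycle of length at least 3. Connectedness includes that there is at least one vertex.\<close>

definition undirected_tree :: "'t pair_pre_digraph \<Rightarrow> bool" where
  "undirected_tree T \<longleftrightarrow> pair_graph T \<and> Digraph_Component.connected (with_proj T) \<and>
     \<not> (\<exists>p. pre_digraph.cycle (with_proj T) p \<and> 3 \<le> length p)"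

definition tree_decomposition ::
    "'a pair_pre_digraph \<Rightarrow> 't pair_pre_digraph \<Rightarrow> ('t \<Rightarrow> 'a set) \<Rightarrow> bool" where
  "tree_decomposition G T \<beta> \<longleftrightarrow>
     undirected_tree T \<and>
     (\<Union>t\<in>pverts T. \<beta> t) = pverts G \<and>
     (\<forall>(u, v)\<in>parcs G. \<exists>t\<in>pverts T. u \<in> \<beta> t \<and> v \<in> \<beta> t) \<and>
     (\<forall>v\<in>pverts G. Digraph_Component.connected (with_proj T \<restriction> {t\<in>pverts T. v \<in> \<beta> t}))"

definition decomposition_width :: "'t pair_pre_digraph \<Rightarrow> ('t \<Rightarrow> 'a set) \<Rightarrow> int" where
  "decomposition_width T \<beta> = Max ((\<lambda>t. int (card (\<beta> t))) ` pverts T) - 1"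

text \<open>Every finite tree is isomorphic to one whose nodes are natural numbers. The width is
  an integer because the graph without vertices has treewidth \<open>-1\<close>.\<close>

definition treewidth :: "'a pair_pre_digraph \<Rightarrow> int" where
  "treewidth G = (LEAST k. \<exists>(T :: nat pair_pre_digraph) \<beta>.
     tree_decomposition G T \<beta> \<and> decomposition_width T \<beta> = k)"

end

theory Submission
  imports Defs
begin

text \<open>
  It suffices to colour the vertices with two colours so that every monochromatic chain with
  steps of length at most \<open>r\<close> has diameter bounded in terms of \<open>r\<close> and the width; this is shown by
  induction on the maximal bag size.  Root the decomposition.  Below a node \<open>\<beta>\<close>, let the core
  consist of the nodes that are joined to \<open>\<beta>\<close> by bags meeting the ball \<open>N\<close> of radius \<open>3r\<close> around
  the bag of \<open>\<beta>\<close>.  Deleting \<open>N\<close> shrinks every core bag, so the core away from \<open>N\<close> is coloured by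
  the induction hypothesis at a larger scale, while a neighbourhood of \<open>N\<close> consists of boundedly
  many bounded sets.  The bags just below the core are far from \<open>\<beta>\<close>; around each of them the
  colours are prescribed on two consecutive layers, one in each colour, which no monochromatic chain
  can cross, and the construction is repeated below.

  The induction only uses the original distances between vertices in a common bag. The walk metric
  through the bags recovers the graph metric, and it makes sense for any subtree of shrunken bags.
\<close>

section \<open>Chains at a fixed scale\<close>

text \<open>One iteration is the bound that \<open>chain_bounded_Un\<close> gives when a ball of
  radius \<open>n\<close>, of diameter at most \<open>2 * n\<close>, is added to a set with bound
  \<open>E\<close> at scale \<open>r\<close>.\<close>

definition absorb :: "nat \<Rightarrow> nat \<Rightarrow> nat \<Rightarrow> nat \<Rightarrow> nat" where
  "absorb n r k D = ((\<lambda>E. 2 * n + 2 * (E + r)) ^^ k) D"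

lemma absorb_mono: "j \<le> k \<Longrightarrow> absorb n r j D \<le> absorb n r k D"
proof (induction rule: dec_induct)
  case (step k)
  then show ?case by (simp add: absorb_def)
qed simp

text \<open>\<open>R n x y\<close> stands for \<open>d(x, y) \<le> n\<close>, where \<open>d\<close> is a pseudometric with values in
  \<open>\<nat> \<union> {\<infinity>}\<close>.\<close>

locale coarse =
  fixes R :: "nat \<Rightarrow> 'a \<Rightarrow> 'a \<Rightarrow> bool"
  assumes R_refl: "R n x x"
    and R_sym: "R n x y \<Longrightarrow> R n y x"
    and R_trans: "R m x y \<Longrightarrow> R n y z \<Longrightarrow> R (m + n) x z"
begin

lemma R_mono: "R m x y \<Longrightarrow> m \<le> n \<Longrightarrow> R n x y"
  using R_trans[of m x y "n - m" y] R_refl by simp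

definition link :: "nat \<Rightarrow> 'a set \<Rightarrow> 'a rel" where
  "link n S = {(x, y). x \<in> S \<and> y \<in> S \<and> R n x y}"

text \<open>The components of the scale-\<open>n\<close> graph on \<open>S\<close> have diameter at
  most \<open>D\<close> in the ambient \<open>R\<close>, however many steps a chain takes. Points
  outside \<open>S\<close> contribute only trivial pairs.\<close>

definition chain_bounded :: "nat \<Rightarrow> 'a set \<Rightarrow> nat \<Rightarrow> bool" where
  "chain_bounded n S D \<longleftrightarrow> (\<forall>x y. (x, y) \<in> (link n S)\<^sup>* \<longrightarrow> R D x y)"

lemma chain_boundedD: "chain_bounded n S D \<Longrightarrow> (x, y) \<in> (link n S)\<^sup>* \<Longrightarrow> R D x y"
  by (simp add: chain_bounded_def)

lemma chain_bounded_mono: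
  assumes "chain_bounded n S D" "S' \<subseteq> S" "n' \<le> n" "D \<le> D'"
  shows "chain_bounded n' S' D'"
proof -
  have "link n' S' \<subseteq> link n S" using assms R_mono by (auto simp: link_def)
  then have "(link n' S')\<^sup>* \<subseteq> (link n S)\<^sup>*" by (rule rtrancl_mono)
  then show ?thesis using assms R_mono unfolding chain_bounded_def by blast
qed

lemma chain_bounded_diam:
  assumes "\<And>x y. x \<in> S \<Longrightarrow> y \<in> S \<Longrightarrow> R D x y"
  shows "chain_bounded n S D"
  unfolding chain_bounded_def
proof (intro allI impI)
  fix x y assume "(x, y) \<in> (link n S)\<^sup>*"
  then have "x = y \<or> (x \<in> S \<and> y \<in> S)" by induction (auto simp: link_def)
  then show "R D x y" using assms R_refl by blast
qed

text \<open>Between visits to \<open>G\<close> a chain makes excursions into \<open>L\<close>, each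
  moving it by at most \<open>D\<^sub>L\<close>. Replacing an excursion and its two end steps by one
  jump turns the visits into a chain of \<open>G\<close> at scale \<open>2 * r + D\<^sub>L\<close>.
  The excursions before the first and after the last visit each add
  \<open>D\<^sub>L + r\<close>.\<close>

lemma chain_bounded_Un:
  assumes L: "chain_bounded r L D\<^sub>L" and G: "chain_bounded (2 * r + D\<^sub>L) G D\<^sub>G"
  shows "chain_bounded r (G \<union> L) (D\<^sub>G + 2 * (D\<^sub>L + r))"
proof -
  let ?s = "2 * r + D\<^sub>L"
  \<comment> \<open>Here \<open>g'\<close> is the last point of \<open>G\<close> visited so far;
    since then the chain has stayed in \<open>L\<close>.\<close>
  have from_G: "\<exists>g'\<in>G. (g, g') \<in> (link ?s G)\<^sup>* \<and>
      (y = g' \<or> (\<exists>l\<in>L. R r g' l \<and> (l, y) \<in> (link r L)\<^sup>*))"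
    if "(g, y) \<in> (link r (G \<union> L))\<^sup>*" "g \<in> G" for g y
    using that
  proof (induction rule: rtrancl_induct)
    case base
    then show ?case by blast
  next
    case (step y z)
    then obtain g' where g': "g' \<in> G" "(g, g') \<in> (link ?s G)\<^sup>*"
      and alt: "y = g' \<or> (\<exists>l\<in>L. R r g' l \<and> (l, y) \<in> (link r L)\<^sup>*)" by blast
    have yz: "R r y z" "z \<in> G \<union> L" using step.hyps(2) by (auto simp: link_def)
    show ?case
    proof (cases "z \<in> G")
      case True
      have "R ?s g' z"
        using alt
      proof
        assume "y = g'"
        then show ?thesis using yz(1) R_mono[of r g' z ?s] by simp
      next
        assume "\<exists>l\<in>L. R r g' l \<and> (l, y) \<in> (link r L)\<^sup>*"
        then obtain l where "R r g' l" "R D\<^sub>L l y" using chain_boundedD[OF L] by blast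
        then have "R (r + D\<^sub>L + r) g' z" using R_trans yz(1) by blast
        then show ?thesis by (rule R_mono) simp
      qed
      then have "(g', z) \<in> link ?s G" using g' True by (simp add: link_def)
      then have "(g, z) \<in> (link ?s G)\<^sup>*" by (rule rtrancl_into_rtrancl[OF g'(2)])
      then show ?thesis using True by blast
    next
      case False
      then have zL: "z \<in> L" using yz by blast
      show ?thesis
        using alt
      proof
        assume "y = g'"
        then show ?thesis using g' zL yz by blast
      next
        assume "\<exists>l\<in>L. R r g' l \<and> (l, y) \<in> (link r L)\<^sup>*"
        then obtain l where l: "l \<in> L" "R r g' l" "(l, y) \<in> (link r L)\<^sup>*" by blast
        have "y \<in> L" using l(3,1) by induction (auto simp: link_def)
        then have "(y, z) \<in> link r L" using zL yz by (simp add: link_def)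
        then have "(l, z) \<in> (link r L)\<^sup>*" by (rule rtrancl_into_rtrancl[OF l(3)])
        then show ?thesis using l g' by blast
      qed
    qed
  qed
  \<comment> \<open>The chain is now peeled from its start: it runs in \<open>L\<close> all the way,
    or up to some \<open>a\<close> that is followed by \<open>g\<close> in \<open>G\<close>. If it
    starts in \<open>G\<close>, then \<open>a\<close> and \<open>g\<close> are both
    \<open>x\<close>.\<close>
  have into_G: "(x, y) \<in> (link r L)\<^sup>* \<or> (\<exists>a g. (x, a) \<in> (link r L)\<^sup>* \<and> R r a g \<and> g \<in> G \<and>
      (g, y) \<in> (link r (G \<union> L))\<^sup>*)"
    if "(x, y) \<in> (link r (G \<union> L))\<^sup>*" for x y
    using that
  proof (induction rule: converse_rtrancl_induct)
    case base
    then show ?case by blast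
  next
    case (step x x')
    have xx: "R r x x'" "x \<in> G \<union> L" "x' \<in> G \<union> L" using step.hyps(1) by (auto simp: link_def)
    show ?case
    proof (cases "x \<in> G")
      case True
      then show ?thesis
        using step.hyps R_refl by (metis converse_rtrancl_into_rtrancl rtrancl.rtrancl_refl)
    next
      case x: False
      show ?thesis
      proof (cases "x' \<in> G")
        case True
        then show ?thesis using xx step.hyps(2) by blast
      next
        case False
        then have "(x, x') \<in> link r L" using xx x by (simp add: link_def)
        then show ?thesis using step.IH by (meson converse_rtrancl_into_rtrancl)
      qed
    qed
  qed
  show ?thesis
    unfolding chain_bounded_def
  proof (intro allI impI)
    fix x y assume "(x, y) \<in> (link r (G \<union> L))\<^sup>*"
    from into_G[OF this] show "R (D\<^sub>G + 2 * (D\<^sub>L + r)) x y"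
    proof
      assume "(x, y) \<in> (link r L)\<^sup>*"
      then show ?thesis using chain_boundedD[OF L] R_mono[of D\<^sub>L] by simp
    next
      assume "\<exists>a g. (x, a) \<in> (link r L)\<^sup>* \<and> R r a g \<and> g \<in> G \<and> (g, y) \<in> (link r (G \<union> L))\<^sup>*"
      then obtain a g where a: "(x, a) \<in> (link r L)\<^sup>*" "R r a g" "g \<in> G"
        "(g, y) \<in> (link r (G \<union> L))\<^sup>*" by blast
      obtain g' where g': "(g, g') \<in> (link ?s G)\<^sup>*"
        and alt: "y = g' \<or> (\<exists>l\<in>L. R r g' l \<and> (l, y) \<in> (link r L)\<^sup>*)"
        using from_G[OF a(4,3)] by blast
      have "R (r + D\<^sub>L) g' y"
        using alt
      proof
        assume "y = g'"
        then show ?thesis using R_refl by simp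
      next
        assume "\<exists>l\<in>L. R r g' l \<and> (l, y) \<in> (link r L)\<^sup>*"
        then show ?thesis using chain_boundedD[OF L] R_trans by blast
      qed
      moreover have "R D\<^sub>L x a" "R D\<^sub>G g g'"
        using chain_boundedD[OF L a(1)] chain_boundedD[OF G g'] .
      ultimately have "R (D\<^sub>L + r + D\<^sub>G + (r + D\<^sub>L)) x y" using a(2) R_trans by blast
      then show ?thesis by (rule R_mono) simp
    qed
  qed
qed

section \<open>Neighbourhoods, and adding boundedly many balls\<close>

definition nb :: "nat \<Rightarrow> 'a set \<Rightarrow> 'a set" where
  "nb n A = {x. \<exists>a\<in>A. R n a x}"

lemma nb_mono: "A \<subseteq> A' \<Longrightarrow> m \<le> n \<Longrightarrow> nb m A \<subseteq> nb n A'"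
  using R_mono by (fastforce simp: nb_def)

lemma nb_trans: "x \<in> nb m A \<Longrightarrow> R n x y \<Longrightarrow> y \<in> nb (m + n) A"
  unfolding nb_def using R_trans[of m _ x n y] by blast

text \<open>By \<open>stay\<close>, a chain never leaves the piece in which it starts, so it is a
  chain of that piece.\<close>

lemma chain_bounded_pieces:
  assumes "\<And>P. P \<in> \<P> \<Longrightarrow> chain_bounded r P D" "S \<subseteq> \<Union>\<P>"
    and stay: "\<And>P x y. P \<in> \<P> \<Longrightarrow> x \<in> P \<Longrightarrow> x \<in> S \<Longrightarrow> y \<in> S \<Longrightarrow> R r x y \<Longrightarrow> y \<in> P"
  shows "chain_bounded r S D"
  unfolding chain_bounded_def
proof (intro allI impI)
  fix x y assume xy: "(x, y) \<in> (link r S)\<^sup>*"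
  show "R D x y"
  proof (cases "x \<in> S")
    case True
    then obtain P where P: "P \<in> \<P>" "x \<in> P" using assms(2) by blast
    from xy have "y \<in> P \<and> (x, y) \<in> (link r P)\<^sup>*"
    proof induction
      case (step y z)
      then have "z \<in> P" using stay[OF P(1), of y z] by (simp add: link_def)
      then have "(y, z) \<in> link r P" using step by (simp add: link_def)
      then show ?case using step.IH \<open>z \<in> P\<close> by (meson rtrancl_into_rtrancl)
    qed (simp add: P)
    then show ?thesis using assms(1)[OF P(1)] chain_boundedD by blast
  next
    case False
    then have "x = y" using xy by (auto elim: converse_rtranclE simp: link_def)
    then show ?thesis by (simp add: R_refl)
  qed
qed

text \<open>The balls around the points of \<open>A\<close> are put back one at a time.\<close>

lemma chain_bounded_absorb:
  assumes "finite A" "card A \<le> k" "chain_bounded r (S - nb n A) D"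
  shows "chain_bounded r S (absorb n r k D)"
proof -
  have "chain_bounded r S (absorb n r (card A) D)"
    using assms(1,3)
  proof (induction A arbitrary: S)
    case empty
    then show ?case by (simp add: absorb_def nb_def)
  next
    case (insert a A)
    let ?K = "nb n {a}" and ?E = "absorb n r (card A) D"
    have "S - nb n (insert a A) = (S - ?K) - nb n A" by (auto simp: nb_def)
    then have "chain_bounded r (S - ?K) ?E" using insert by simp
    \<comment> \<open>A ball is bounded at every scale, so it can be the part for which
      \<open>chain_bounded_Un\<close> demands the larger scale.\<close>
    moreover have "chain_bounded (2 * r + ?E) (S \<inter> ?K) (2 * n)"
    proof (rule chain_bounded_diam)
      fix x y assume "x \<in> S \<inter> ?K" "y \<in> S \<inter> ?K"
      then have "R n x a" "R n a y" using R_sym by (auto simp: nb_def)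
      then show "R (2 * n) x y" using R_trans by (auto simp: mult_2)
    qed
    ultimately have "chain_bounded r ((S \<inter> ?K) \<union> (S - ?K)) (2 * n + 2 * (?E + r))"
      by (rule chain_bounded_Un)
    moreover have "(S \<inter> ?K) \<union> (S - ?K) = S" by blast
    ultimately show ?case using insert.hyps by (simp add: absorb_def)
  qed
  then show ?thesis
    by (rule chain_bounded_mono) (simp_all add: absorb_mono assms(2))
qed

end

section \<open>Walks through bags\<close>

text \<open>\<open>reach_refl\<close> admits every \<open>n\<close>, so \<open>n\<close> is an upper
  bound for the length of the walk. A step inside a bag costs its original
  \<open>R\<close>-distance, even if no path within the bags realises it.\<close>

inductive reach :: "(nat \<Rightarrow> 'a \<Rightarrow> 'a \<Rightarrow> bool) \<Rightarrow> 'a set set \<Rightarrow> nat \<Rightarrow> 'a \<Rightarrow> 'a \<Rightarrow> bool"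
  for R \<B> where
  reach_refl: "reach R \<B> n x x"
| reach_step: "reach R \<B> m x y \<Longrightarrow> C \<in> \<B> \<Longrightarrow> y \<in> C \<Longrightarrow> z \<in> C \<Longrightarrow> R n y z \<Longrightarrow> reach R \<B> (m + n) x z"

lemma reach_edge: "C \<in> \<B> \<Longrightarrow> x \<in> C \<Longrightarrow> y \<in> C \<Longrightarrow> R n x y \<Longrightarrow> reach R \<B> n x y"
  using reach_step[OF reach_refl[of R \<B> 0 x], of C y n] by simp

lemma reach_step_image:
  "reach R (B ` T) m x y \<Longrightarrow> t \<in> T \<Longrightarrow> y \<in> B t \<Longrightarrow> z \<in> B t \<Longrightarrow> R n y z \<Longrightarrow>
    reach R (B ` T) (m + n) x z"
  by (rule reach_step[where C = "B t"]) simp_all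

lemma reach_refine:
  assumes "reach R \<B> n x y" "\<And>C. C \<in> \<B> \<Longrightarrow> \<exists>C'\<in>\<B>'. C \<subseteq> C'"
  shows "reach R \<B>' n x y"
  using assms(1)
proof induction
  case (reach_step m x y C z n)
  then show ?case using assms(2) by (meson reach.reach_step subsetD)
qed (rule reach_refl)

context coarse
begin

lemma reach_imp_R: "reach R \<B> n x y \<Longrightarrow> R n x y"
  by (induction rule: reach.induct) (auto intro: R_refl R_trans)

lemma reach_mono: "reach R \<B> m x y \<Longrightarrow> m \<le> n \<Longrightarrow> reach R \<B> n x y"
proof (induction arbitrary: n rule: reach.induct)
  case (reach_step m x y C z l)
  have "reach R \<B> (n - l) x y" using reach_step by simp
  then have "reach R \<B> (n - l + l) x z" using reach_step.hyps by (blast intro: reach.reach_step)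
  then show ?case using reach_step.prems by simp
qed (rule reach_refl)

text \<open>The second walk is the first premise because the induction runs along it, appending its
  steps to the other walk.\<close>

lemma reach_trans: "reach R \<B> n y z \<Longrightarrow> reach R \<B> m x y \<Longrightarrow> reach R \<B> (m + n) x z"
proof (induction arbitrary: m rule: reach.induct)
  case (reach_refl n x)
  then show ?case by (rule reach_mono) simp
next
  case (reach_step k y z C u l)
  have "reach R \<B> (m + k + l) x u"
    using reach.reach_step[OF reach_step.IH[OF reach_step.prems] reach_step.hyps(2-5)] .
  then show ?case by (simp add: add.assoc)
qed

lemma reach_sym: "reach R \<B> n x y \<Longrightarrow> reach R \<B> n y x"
proof (induction rule: reach.induct)
  case (reach_step m x y C z n)
  have "reach R \<B> n z y" using reach_step.hyps R_sym by (blast intro: reach_edge)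
  then show ?case using reach_step.IH reach_trans by (metis add.commute)
qed (rule reach_refl)

lemma coarse_reach: "coarse (reach R \<B>)"
  by unfold_locales (blast intro: reach_refl reach_sym reach_trans)+

end

section \<open>Rooted trees of bags\<close>

definition anc :: "('t \<Rightarrow> 't) \<Rightarrow> 't \<Rightarrow> 't \<Rightarrow> bool" where
  "anc p \<gamma> t \<longleftrightarrow> (\<exists>i. (p ^^ i) t = \<gamma>)"

lemma anc_refl: "anc p t t"
  unfolding anc_def by (rule exI[of _ 0]) simp

lemma anc_parent: "anc p (p t) t"
  unfolding anc_def by (rule exI[of _ 1]) simp

lemma anc_trans:
  assumes "anc p \<gamma> t" "anc p t s"
  shows "anc p \<gamma> s"
proof -
  from assms obtain i j where "(p ^^ i) t = \<gamma>" "(p ^^ j) s = t" unfolding anc_def by blast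
  then have "(p ^^ (i + j)) s = \<gamma>" by (simp add: funpow_add)
  then show ?thesis unfolding anc_def ..
qed

lemma anc_step:
  assumes "anc p \<gamma> t" "\<gamma> \<noteq> t"
  shows "anc p \<gamma> (p t)"
proof -
  from assms(1) obtain i where i: "(p ^^ i) t = \<gamma>" unfolding anc_def ..
  with assms(2) obtain j where "i = Suc j" by (cases i) auto
  with i have "(p ^^ j) (p t) = \<gamma>" by (simp add: funpow_swap1)
  then show ?thesis unfolding anc_def ..
qed

lemma anc_linear:
  assumes "anc p \<gamma> t" "anc p \<gamma>' t"
  shows "anc p \<gamma> \<gamma>' \<or> anc p \<gamma>' \<gamma>"
proof -
  have *: "anc p ((p ^^ j) t) ((p ^^ i) t)" if "i \<le> j" for i j
  proof -
    have "(p ^^ (j - i)) ((p ^^ i) t) = (p ^^ (j - i + i)) t" by (simp only: funpow_add comp_apply)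
    then have "(p ^^ (j - i)) ((p ^^ i) t) = (p ^^ j) t" using that by simp
    then show ?thesis unfolding anc_def ..
  qed
  from assms obtain i j where "(p ^^ i) t = \<gamma>" "(p ^^ j) t = \<gamma>'" unfolding anc_def by blast
  then show ?thesis using *[of i j] *[of j i] by (cases "i \<le> j") auto
qed

text \<open>\<open>coherent\<close> expresses, edge by edge, that the nodes whose bags contain
  \<open>v\<close> are connected. \<open>p\<close> and \<open>rk\<close> are total and
  \<open>p \<rho>\<close> may lie outside \<open>S\<close>, so a subtree can inherit both
  unchanged.\<close>

locale rooted_bags = coarse R for R :: "nat \<Rightarrow> 'a \<Rightarrow> 'a \<Rightarrow> bool" +
  fixes p :: "'t \<Rightarrow> 't" and rk :: "'t \<Rightarrow> nat" and S :: "'t set" and \<rho> :: 't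
    and B :: "'t \<Rightarrow> 'a set"
  assumes rank: "p t = t \<or> rk (p t) < rk t"
    and finite_nodes: "finite S"
    and root: "\<rho> \<in> S"
    and below_root: "t \<in> S \<Longrightarrow> anc p \<rho> t"
    and parent: "t \<in> S \<Longrightarrow> t \<noteq> \<rho> \<Longrightarrow> p t \<in> S"
    and coherent: "\<gamma> \<in> S \<Longrightarrow> t \<in> S \<Longrightarrow> t' \<in> S \<Longrightarrow> anc p \<gamma> t \<Longrightarrow> \<not> anc p \<gamma> t' \<Longrightarrow>
      v \<in> B t \<Longrightarrow> v \<in> B t' \<Longrightarrow> v \<in> B \<gamma> \<inter> B (p \<gamma>)"
begin

abbreviation dS :: "nat \<Rightarrow> 'a \<Rightarrow> 'a \<Rightarrow> bool" where
  "dS \<equiv> reach R (B ` S)"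

sublocale dS: coarse dS
  by (rule coarse_reach)

definition desc :: "'t \<Rightarrow> 't set" where
  "desc \<gamma> = {t \<in> S. anc p \<gamma> t}"

text \<open>The adhesion set of the edge above \<open>\<gamma>\<close>.\<close>

definition door :: "'t \<Rightarrow> 'a set" where
  "door \<gamma> = B \<gamma> \<inter> B (p \<gamma>)"

lemma anc_rank: "anc p \<gamma> t \<Longrightarrow> \<gamma> = t \<or> rk \<gamma> < rk t"
proof -
  have "(p ^^ i) t = t \<or> rk ((p ^^ i) t) < rk t" for i
  proof (induction i)
    case (Suc i)
    then show ?case using rank[of "(p ^^ i) t"] by auto
  qed simp
  then show "anc p \<gamma> t \<Longrightarrow> \<gamma> = t \<or> rk \<gamma> < rk t" by (auto simp: anc_def)
qed

lemma anc_antisym: "anc p \<gamma> t \<Longrightarrow> anc p t \<gamma> \<Longrightarrow> \<gamma> = t"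
  using anc_rank[of \<gamma> t] anc_rank[of t \<gamma>] by auto

lemma door_subset: "door \<gamma> \<subseteq> B \<gamma>"
  by (simp add: door_def)

lemma in_door:
  assumes "\<gamma> \<in> S" "v \<in> \<Union>(B ` desc \<gamma>)" "v \<in> \<Union>(B ` (S - desc \<gamma>))"
  shows "v \<in> door \<gamma>"
  using assms coherent[of \<gamma>] by (auto simp: desc_def door_def)

text \<open>A walk that leaves the bags below \<open>\<gamma>\<close> does so at a vertex shared
  with another bag, which lies in the door by coherence.\<close>

lemma separation:
  assumes "\<gamma> \<in> S" "dS n x y" "x \<in> \<Union>(B ` desc \<gamma>)" "y \<in> \<Union>(B ` (S - desc \<gamma>))"
  obtains b where "b \<in> door \<gamma>" "dS n x b" "dS n b y"
proof -
  \<comment> \<open>Until a door vertex is met, the current vertex stays in a bag below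
    \<open>\<gamma>\<close>; the first step in any other bag starts at a door vertex.\<close>
  have "(\<exists>b\<in>door \<gamma>. dS n x b \<and> dS n b y) \<or> y \<in> \<Union>(B ` desc \<gamma>)"
    using assms(2,3)
  proof (induction rule: reach.induct)
    case (reach_step m x y C z l)
    have mono: "m \<le> m + l" by simp
    have xy: "dS m x y" "dS (m + l) x z"
      by (rule reach_step.hyps(1), rule reach.reach_step[OF reach_step.hyps])
    have yz: "dS l y z" by (rule reach_edge) (fact reach_step.hyps)+
    from reach_step.IH[OF reach_step.prems] show ?case
    proof
      assume "\<exists>b\<in>door \<gamma>. dS m x b \<and> dS m b y"
      then obtain b where "b \<in> door \<gamma>" "dS m x b" "dS m b y" by blast
      then have "b \<in> door \<gamma>" "dS (m + l) x b" "dS (m + l) b z"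
        by (simp, intro reach_mono[OF _ mono], simp, intro reach_trans[OF yz])
      then show ?thesis by blast
    next
      assume y: "y \<in> \<Union>(B ` desc \<gamma>)"
      obtain t where t: "t \<in> S" "C = B t" using reach_step.hyps by blast
      show ?thesis
      proof (cases "t \<in> desc \<gamma>")
        case True
        then show ?thesis using t reach_step.hyps by blast
      next
        case False
        then have "y \<in> door \<gamma>" using in_door[OF assms(1) y] t reach_step.hyps by blast
        then show ?thesis using reach_mono[OF xy(1) mono] reach_mono[OF yz, of "m + l"] by auto
      qed
    qed
  qed simp
  then show thesis
  proof
    assume "y \<in> \<Union>(B ` desc \<gamma>)"
    then have "y \<in> door \<gamma>" using in_door assms by blast
    then show thesis using that assms(2) reach_refl by metis
  qed (use that in blast)
qed

end

section \<open>The core of a subtree and the front below it\<close>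

locale region = rooted_bags R p rk S \<rho> B
  for R :: "nat \<Rightarrow> 'a \<Rightarrow> 'a \<Rightarrow> bool" and p :: "'t \<Rightarrow> 't" and rk S \<rho> B +
  fixes \<beta> :: 't and M :: nat
  assumes top: "\<beta> \<in> S"
begin

definition zone :: "'a set" where
  "zone = dS.nb M (B \<beta>)"

text \<open>\<open>\<beta>\<close> is exempt so that it belongs to the core even when its bag is
  empty.\<close>

definition core :: "'t set" where
  "core = {t \<in> desc \<beta>. \<forall>\<gamma>\<in>desc \<beta>. anc p \<gamma> t \<longrightarrow> \<gamma> \<noteq> \<beta> \<longrightarrow> B \<gamma> \<inter> zone \<noteq> {}}"

definition front :: "'t set" where
  "front = {\<gamma> \<in> desc \<beta>. \<gamma> \<noteq> \<beta> \<and> B \<gamma> \<inter> zone = {} \<and> p \<gamma> \<in> core}"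

lemma core_subset: "core \<subseteq> desc \<beta>" "core \<subseteq> S"
  by (auto simp: core_def desc_def)

lemma coreI:
  assumes "t \<in> S" "anc p \<beta> t"
    and "\<And>\<gamma>. \<gamma> \<in> S \<Longrightarrow> anc p \<beta> \<gamma> \<Longrightarrow> anc p \<gamma> t \<Longrightarrow> \<gamma> \<noteq> \<beta> \<Longrightarrow> B \<gamma> \<inter> zone \<noteq> {}"
  shows "t \<in> core"
  using assms by (simp add: core_def desc_def)

lemma coreD:
  assumes "t \<in> core"
  shows "t \<in> S" "anc p \<beta> t"
    and "\<And>\<gamma>. \<gamma> \<in> S \<Longrightarrow> anc p \<beta> \<gamma> \<Longrightarrow> anc p \<gamma> t \<Longrightarrow> \<gamma> \<noteq> \<beta> \<Longrightarrow> B \<gamma> \<inter> zone \<noteq> {}"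
  using assms by (simp_all add: core_def desc_def)

lemma top_in_core: "\<beta> \<in> core"
proof (rule coreI)
  fix \<gamma> assume "anc p \<beta> \<gamma>" "anc p \<gamma> \<beta>" "\<gamma> \<noteq> \<beta>"
  then have False using anc_antisym[of \<beta> \<gamma>] by simp
  then show "B \<gamma> \<inter> zone \<noteq> {}" ..
qed (rule top, rule anc_refl)

lemma top_bag_in_zone: "B \<beta> \<subseteq> zone"
  by (auto simp: zone_def dS.nb_def intro: reach_refl)

text \<open>This drives the induction on bag size: deleting the zone removes a vertex from every
  nonempty core bag.\<close>

lemma core_bag_zone: "t \<in> core \<Longrightarrow> B t \<noteq> {} \<Longrightarrow> B t \<inter> zone \<noteq> {}"
  using top_bag_in_zone coreD[of t] anc_refl[of p t] by (cases "t = \<beta>") auto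

lemma desc_parent:
  assumes "t \<in> desc \<beta>" "t \<noteq> \<beta>"
  shows "p t \<in> desc \<beta>" "p t \<noteq> t"
proof -
  have "t \<in> S" "anc p \<beta> t" using assms by (auto simp: desc_def)
  moreover from this have "t \<noteq> \<rho>" using below_root[OF top] anc_antisym[of \<beta> t] assms(2) by auto
  ultimately show "p t \<in> desc \<beta>"
    using parent[of t] anc_step[of p \<beta> t] assms(2) by (simp add: desc_def)
  show "p t \<noteq> t"
  proof
    assume pt: "p t = t"
    have "(p ^^ i) t = t" for i by (induction i) (simp_all add: pt)
    then show False using \<open>anc p \<beta> t\<close> assms(2) by (simp add: anc_def)
  qed
qed

lemma core_parent:
  assumes "t \<in> core" "t \<noteq> \<beta>"
  shows "p t \<in> core"
proof (rule coreI)
  show "p t \<in> S" "anc p \<beta> (p t)"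
    using desc_parent(1)[of t] assms core_subset by (auto simp: desc_def)
  fix \<gamma> assume "\<gamma> \<in> S" "anc p \<beta> \<gamma>" "anc p \<gamma> (p t)" "\<gamma> \<noteq> \<beta>"
  then show "B \<gamma> \<inter> zone \<noteq> {}"
    using coreD(3)[OF assms(1), of \<gamma>] anc_trans[OF _ anc_parent] by metis
qed

text \<open>The induction hypothesis will be applied to this system. Coherence survives passing to
  fewer nodes and deleting the same vertices from all bags.\<close>

lemma core_rooted: "rooted_bags R p rk core \<beta> (\<lambda>t. B t - zone)"
proof (unfold_locales)
  show "finite core" using core_subset(2) finite_nodes by (rule finite_subset)
  show "anc p \<beta> t" if "t \<in> core" for t using that by (rule coreD)
  show "v \<in> (B \<gamma> - zone) \<inter> (B (p \<gamma>) - zone)"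
    if "\<gamma> \<in> core" "t \<in> core" "t' \<in> core" "anc p \<gamma> t" "\<not> anc p \<gamma> t'" "v \<in> B t - zone" "v \<in> B t' - zone"
    for \<gamma> t t' v
    using coherent[of \<gamma> t t' v] that coreD(1) by simp
  show "p t = t \<or> rk (p t) < rk t" for t by (rule rank)
qed (fact top_in_core core_parent)+

lemma frontD:
  assumes "\<gamma> \<in> front"
  shows "\<gamma> \<in> S" "\<gamma> \<in> desc \<beta>" "B \<gamma> \<inter> zone = {}" "p \<gamma> \<in> core" "desc \<gamma> \<subseteq> desc \<beta>" "\<beta> \<notin> desc \<gamma>"
    "desc \<gamma> \<inter> core = {}"
proof -
  show *: "\<gamma> \<in> S" "\<gamma> \<in> desc \<beta>" "B \<gamma> \<inter> zone = {}" "p \<gamma> \<in> core"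
    using assms by (auto simp: front_def desc_def)
  then have anc: "anc p \<beta> \<gamma>" by (simp add: desc_def)
  then show "desc \<gamma> \<subseteq> desc \<beta>" using anc_trans[of p \<beta> \<gamma>] by (auto simp: desc_def)
  have "\<gamma> \<noteq> \<beta>" using assms by (simp add: front_def)
  then show "\<beta> \<notin> desc \<gamma>" using anc_antisym[OF anc] by (auto simp: desc_def)
  show "desc \<gamma> \<inter> core = {}"
    using *(1,3) anc \<open>\<gamma> \<noteq> \<beta>\<close> coreD(3)[of _ \<gamma>] by (auto simp: desc_def)
qed

text \<open>Among the ancestors of \<open>t\<close> that violate the core condition, the topmost one
  is a front node.\<close>

lemma front_cover:
  assumes "t \<in> desc \<beta>" "t \<notin> core"
  obtains \<gamma> where "\<gamma> \<in> front" "t \<in> desc \<gamma>"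
proof -
  define bad where "bad \<gamma> \<longleftrightarrow> \<gamma> \<in> desc \<beta> \<and> anc p \<gamma> t \<and> \<gamma> \<noteq> \<beta> \<and> B \<gamma> \<inter> zone = {}" for \<gamma>
  obtain \<gamma>\<^sub>0 where "bad \<gamma>\<^sub>0" using assms by (auto simp: core_def bad_def)
  then obtain \<gamma> where \<gamma>: "bad \<gamma>" and min: "\<And>\<gamma>'. bad \<gamma>' \<Longrightarrow> rk \<gamma> \<le> rk \<gamma>'"
    using ex_has_least_nat[of bad \<gamma>\<^sub>0 rk] by blast
  have "\<gamma> \<in> desc \<beta>" "\<gamma> \<noteq> \<beta>" using \<gamma> by (auto simp: bad_def)
  note pg = desc_parent[OF this]
  \<comment> \<open>Otherwise a violating ancestor of \<open>p \<gamma>\<close> would have smaller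
    rank than \<open>\<gamma>\<close>.\<close>
  have "p \<gamma> \<in> core"
  proof (rule ccontr)
    assume "p \<gamma> \<notin> core"
    then obtain \<gamma>' where g': "\<gamma>' \<in> desc \<beta>" "anc p \<gamma>' (p \<gamma>)" "\<gamma>' \<noteq> \<beta>" "B \<gamma>' \<inter> zone = {}"
      using coreI[of "p \<gamma>"] pg(1) by (auto simp: desc_def)
    have "anc p \<gamma>' t"
      using anc_trans[OF anc_trans[OF g'(2) anc_parent]] \<gamma> by (simp add: bad_def)
    then have "rk \<gamma> \<le> rk \<gamma>'" using min g' by (simp add: bad_def)
    moreover have "rk \<gamma>' \<le> rk (p \<gamma>)" using anc_rank[OF g'(2)] by auto
    moreover have "rk (p \<gamma>) < rk \<gamma>" using rank pg(2) by blast
    ultimately show False by simp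
  qed
  then have "\<gamma> \<in> front" using \<gamma> by (auto simp: front_def bad_def)
  moreover have "t \<in> desc \<gamma>" using \<gamma> assms by (auto simp: desc_def bad_def)
  ultimately show thesis by (rule that)
qed

text \<open>Two ancestors of \<open>t\<close> are comparable. If they were distinct front nodes, the
  parent of the lower one would be a core node below the upper one.\<close>

lemma front_disjoint:
  assumes "\<gamma> \<in> front" "\<gamma>' \<in> front" "t \<in> desc \<gamma>" "t \<in> desc \<gamma>'"
  shows "\<gamma> = \<gamma>'"
proof (rule ccontr)
  have *: False if "\<gamma> \<in> front" "\<gamma>' \<in> front" "anc p \<gamma> \<gamma>'" "\<gamma> \<noteq> \<gamma>'" for \<gamma> \<gamma>'
  proof -
    have "p \<gamma>' \<in> desc \<gamma>"
      using anc_step[OF that(3,4)] coreD(1)[OF frontD(4)[OF that(2)]] by (simp add: desc_def)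
    then show False using frontD(4)[OF that(2)] frontD(7)[OF that(1)] by blast
  qed
  assume "\<gamma> \<noteq> \<gamma>'"
  then show False
    using anc_linear[of p \<gamma> t \<gamma>'] assms *[of \<gamma> \<gamma>'] *[of \<gamma>' \<gamma>] by (auto simp: desc_def)
qed

text \<open>A walk may leave the core, but it returns through the bag where it left, and there its
  detour can be replaced by a single step.\<close>

lemma core_convex:
  assumes "dS n x y" "x \<in> \<Union>(B ` core)" "y \<in> \<Union>(B ` core)"
  shows "reach R (B ` core) n x y"
proof -
  define out where "out = S - core"
  \<comment> \<open>The core node at which the component of \<open>out\<close> containing
    \<open>t\<close> is attached: \<open>\<beta>\<close> outside the subtree of
    \<open>\<beta>\<close>, and the parent of the front node above \<open>t\<close> inside
    it.\<close>
  define gate where "gate t = (if t \<in> desc \<beta> then p (SOME \<gamma>. \<gamma> \<in> front \<and> t \<in> desc \<gamma>) else \<beta>)" for t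
  have gate_front: "gate t = p \<gamma>" if "\<gamma> \<in> front" "t \<in> desc \<gamma>" for t \<gamma>
  proof -
    have "(SOME \<gamma>. \<gamma> \<in> front \<and> t \<in> desc \<gamma>) = \<gamma>"
      using that front_disjoint by (intro some_equality) auto
    then show ?thesis using that frontD(5)[OF that(1)] by (auto simp: gate_def)
  qed
  have out_cases: "(t \<in> S \<and> t \<notin> desc \<beta> \<and> gate t = \<beta>) \<or> (\<exists>\<gamma>\<in>front. t \<in> desc \<gamma> \<and> gate t = p \<gamma>)"
    if "t \<in> out" for t
  proof (cases "t \<in> desc \<beta>")
    case True
    moreover have "t \<notin> core" using that by (simp add: out_def)
    ultimately obtain \<gamma> where "\<gamma> \<in> front" "t \<in> desc \<gamma>" by (rule front_cover)
    then show ?thesis using gate_front by blast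
  next
    case False
    then show ?thesis using that by (simp add: out_def gate_def)
  qed
  have gate_core: "gate t \<in> core" if "t \<in> out" for t
    using out_cases[OF that]
  proof
    assume "\<exists>\<gamma>\<in>front. t \<in> desc \<gamma> \<and> gate t = p \<gamma>"
    then show ?thesis using frontD(4) by auto
  qed (simp add: top_in_core)
  \<comment> \<open>A vertex shared by the core and an outside bag lies in the door of the
    separating edge, hence in the bag of the gate.\<close>
  have border: "v \<in> B (gate t)" if "t \<in> out" "v \<in> B t" "v \<in> \<Union>(B ` core)" for t v
    using out_cases[OF that(1)]
  proof
    assume t: "t \<in> S \<and> t \<notin> desc \<beta> \<and> gate t = \<beta>"
    then have "v \<in> door \<beta>" using in_door[OF top, of v] that(2,3) core_subset(1) by blast
    then show ?thesis using t door_subset[of \<beta>] by auto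
  next
    assume "\<exists>\<gamma>\<in>front. t \<in> desc \<gamma> \<and> gate t = p \<gamma>"
    then obtain \<gamma> where g: "\<gamma> \<in> front" "t \<in> desc \<gamma>" "gate t = p \<gamma>" by blast
    then have "v \<in> door \<gamma>"
      using in_door[OF frontD(1)[OF g(1)], of v] that(2,3) core_subset(2) frontD(7)[OF g(1)] by blast
    then show ?thesis using g by (auto simp: door_def)
  qed
  \<comment> \<open>A vertex that occurs in no core bag cannot occur on both sides of a door, so all
    outside bags containing it have the same gate.\<close>
  have same_gate: "gate t = gate t'"
    if tt: "t \<in> out" "t' \<in> out" "v \<in> B t" "v \<in> B t'" "v \<notin> \<Union>(B ` core)" for t t' v
  proof -
    have front_case: "t' \<in> desc \<gamma>"
      if "\<gamma> \<in> front" "t \<in> desc \<gamma>" "t' \<in> S" "v \<in> B t" "v \<in> B t'" for t t' \<gamma>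
    proof (rule ccontr)
      assume "t' \<notin> desc \<gamma>"
      then have "v \<in> B (p \<gamma>)"
        using in_door[OF frontD(1)[OF that(1)], of v] that by (auto simp: door_def)
      then show False using frontD(4)[OF that(1)] tt(5) by blast
    qed
    have "t \<in> S" "t' \<in> S" using tt by (auto simp: out_def)
    show ?thesis
    proof (cases "gate t = \<beta> \<and> gate t' = \<beta>")
      case False
      then have "(\<exists>\<gamma>\<in>front. t \<in> desc \<gamma>) \<or> (\<exists>\<gamma>\<in>front. t' \<in> desc \<gamma>)"
        using out_cases[OF tt(1)] out_cases[OF tt(2)] by blast
      then obtain \<gamma> where "\<gamma> \<in> front" "t \<in> desc \<gamma>" "t' \<in> desc \<gamma>"
        using front_case[of _ t t'] front_case[of _ t' t] tt(3,4) \<open>t \<in> S\<close> \<open>t' \<in> S\<close> by blast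
      then show ?thesis using gate_front by simp
    qed simp
  qed
  \<comment> \<open>During a detour, \<open>q\<close> is the vertex where the walk left the core and
    \<open>j\<close> bounds the \<open>R\<close>-distance travelled since. The returning vertex lies
    in the same gate bag as \<open>q\<close>, so one step there replaces the detour.\<close>
  have "(y \<in> \<Union>(B ` core) \<and> reach R (B ` core) n x y) \<or>
    (y \<notin> \<Union>(B ` core) \<and> (\<exists>q i j t. reach R (B ` core) i x q \<and> R j q y \<and> i + j = n \<and>
       t \<in> out \<and> y \<in> B t \<and> q \<in> B (gate t)))"
    using assms(1,2)
  proof (induction rule: reach.induct)
    case (reach_refl n x)
    then show ?case by (simp add: reach.reach_refl)
  next
    case (reach_step m x y C z l)
    obtain t where t: "t \<in> S" "y \<in> B t" "z \<in> B t" using reach_step.hyps by blast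
    note yz = \<open>R l y z\<close>
    from reach_step.IH[OF reach_step.prems] show ?case
    proof
      assume y: "y \<in> \<Union>(B ` core) \<and> reach R (B ` core) m x y"
      show ?thesis
      proof (cases "t \<in> core")
        case True
        then have "reach R (B ` core) (m + l) x z"
          using reach_step_image[where R = R and B = B, OF _ True t(2,3) yz] y by simp
        then show ?thesis using True t by blast
      next
        case False
        then have "t \<in> out" using t by (simp add: out_def)
        then have yg: "y \<in> B (gate t)" using border t y by blast
        show ?thesis
        proof (cases "z \<in> \<Union>(B ` core)")
          case True
          then have "z \<in> B (gate t)" using border t \<open>t \<in> out\<close> by blast
          then have "reach R (B ` core) (m + l) x z"
            using reach_step_image[where R = R and B = B, OF _ gate_core[OF \<open>t \<in> out\<close>] yg _ yz] y by simp
          then show ?thesis using True by blast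
        next
          case False
          then show ?thesis using y yg yz t \<open>t \<in> out\<close> by blast
        qed
      qed
    next
      assume "y \<notin> \<Union>(B ` core) \<and> (\<exists>q i j t. reach R (B ` core) i x q \<and> R j q y \<and> i + j = m \<and>
       t \<in> out \<and> y \<in> B t \<and> q \<in> B (gate t))"
      then obtain q i j t' where y: "y \<notin> \<Union>(B ` core)" and q: "reach R (B ` core) i x q" "R j q y"
        "i + j = m" "t' \<in> out" "y \<in> B t'" "q \<in> B (gate t')" by blast
      have "t \<in> out" using y t by (auto simp: out_def)
      then have gate: "q \<in> B (gate t)" using same_gate[OF _ q(4) t(2) q(5) y] q(6) by simp
      have qz: "R (j + l) q z" using R_trans q(2) yz .
      have sum: "i + (j + l) = m + l" using q(3) by simp
      show ?thesis
      proof (cases "z \<in> \<Union>(B ` core)")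
        case True
        then have "z \<in> B (gate t)" using border t \<open>t \<in> out\<close> by blast
        then have "reach R (B ` core) (i + (j + l)) x z"
          by (rule reach_step_image[OF q(1) gate_core[OF \<open>t \<in> out\<close>] gate _ qz])
        then show ?thesis using True sum by auto
      next
        case False
        then show ?thesis using q(1) qz sum \<open>t \<in> out\<close> t gate by blast
      qed
    qed
  qed
  then show ?thesis using assms(3) by blast
qed

text \<open>Every vertex of the walk is within \<open>n\<close> of \<open>x\<close>, so one in the
  zone would put \<open>x\<close> within \<open>M + n\<close> of the bag of
  \<open>\<beta>\<close>.\<close>

lemma avoid_zone:
  assumes "reach R (B ` core) n x y" "x \<notin> dS.nb (M + n) (B \<beta>)"
  shows "reach R ((\<lambda>t. B t - zone) ` core) n x y"
  using assms
proof (induction rule: reach.induct)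
  case (reach_step m x y C z l)
  have away: "v \<notin> zone" if "reach R (B ` core) k x v" "k \<le> m + l" for k v
  proof
    assume "v \<in> zone"
    moreover have "dS k v x"
      using reach_refine[OF that(1), of "B ` S"] core_subset reach_sym by blast
    ultimately have "x \<in> dS.nb (M + k) (B \<beta>)" unfolding zone_def by (rule dS.nb_trans)
    then show False using reach_step.prems dS.nb_mono[of "B \<beta>" "B \<beta>" "M + k" "M + (m + l)"] that(2) by auto
  qed
  have "x \<notin> dS.nb (M + m) (B \<beta>)"
    using reach_step.prems dS.nb_mono[of "B \<beta>" "B \<beta>" "M + m" "M + (m + l)"] by auto
  then have xy: "reach R ((\<lambda>t. B t - zone) ` core) m x y" by (rule reach_step.IH)
  obtain t where t: "t \<in> core" "C = B t" using reach_step.hyps by blast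
  have "reach R (B ` core) (m + l) x z" by (rule reach.reach_step[OF reach_step.hyps])
  then have "z \<notin> zone" by (rule away) simp
  moreover have "y \<notin> zone" using reach_step.hyps(1) by (rule away) simp
  ultimately show ?case
    using reach_step_image[OF xy t(1)] t(2) reach_step.hyps(3-5) by simp
qed (rule reach_refl)

end

section \<open>Colouring a tree of bags\<close>

text \<open>A ring lies within \<open>2 * r\<close> of a door of at most \<open>k\<close> vertices,
  so absorbing these balls leaves nothing and starts from \<open>0\<close>.\<close>

definition ring_bound :: "nat \<Rightarrow> nat \<Rightarrow> nat" where
  "ring_bound k r = absorb (2 * r) r k 0"

text \<open>Adding the rings requires the scale \<open>2 * r + ring_bound k r\<close>; moving both
  ends of such a jump to core vertices costs another \<open>r\<close> each.\<close>

definition body_scale :: "nat \<Rightarrow> nat \<Rightarrow> nat" where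
  "body_scale k r = 4 * r + ring_bound k r"

text \<open>\<open>E + 2 * r\<close> is the bound away from the rings, the next summand pays for
  adding the rings, and \<open>absorb\<close> adds the neighbourhood of the bag of
  \<open>\<beta>\<close>.\<close>

definition body_bound :: "nat \<Rightarrow> nat \<Rightarrow> nat \<Rightarrow> nat" where
  "body_bound k r E = absorb (3 * r + body_scale k r + r) r k (E + 2 * r + 2 * (ring_bound k r + r))"

text \<open>The outer \<open>absorb\<close> pays for the ball of radius \<open>2 * r\<close> around
  the door of the root.\<close>

fun colour_bound :: "nat \<Rightarrow> nat \<Rightarrow> nat" where
  "colour_bound 0 r = 0"
| "colour_bound (Suc k) r = absorb (2 * r) r (Suc k)
     (body_bound (Suc k) r (colour_bound k (body_scale (Suc k) r)))"

section \<open>Colourings with a prescribed layer near the door\<close>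

context rooted_bags
begin

definition far :: "nat \<Rightarrow> 't \<Rightarrow> 'a set" where
  "far r \<gamma> = \<Union>(B ` desc \<gamma>) - dS.nb (2 * r) (door \<gamma>)"

text \<open>The second clause is the interface to the enclosing region, which colours the points
  within \<open>2 * r\<close> of the door itself.\<close>

definition good_colouring :: "nat \<Rightarrow> nat \<Rightarrow> 't \<Rightarrow> ('a \<Rightarrow> bool) \<Rightarrow> bool" where
  "good_colouring r D \<gamma> c \<longleftrightarrow>
     (\<forall>i. dS.chain_bounded r {x \<in> far r \<gamma>. c x = i} D) \<and>
     (\<forall>x\<in>far r \<gamma> \<inter> dS.nb (3 * r) (door \<gamma>). c x)"

lemma door_card:
  assumes "finite (B \<gamma>) \<and> card (B \<gamma>) \<le> k"
  shows "finite (door \<gamma>)" "card (door \<gamma>) \<le> k"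
  using assms finite_subset[OF door_subset, of \<gamma>] card_mono[OF _ door_subset, of \<gamma>] by auto

lemma nb_door_separation:
  assumes "\<gamma> \<in> S" "dS n x y" "x \<in> \<Union>(B ` desc \<gamma>)" "y \<in> \<Union>(B ` (S - desc \<gamma>))"
  shows "x \<in> dS.nb n (door \<gamma>)"
proof -
  obtain b where "b \<in> door \<gamma>" "dS n x b" using separation[OF assms] by blast
  then show ?thesis using reach_sym[of "B ` S" n x b] by (auto simp: dS.nb_def)
qed

end

context region
begin

lemma front_bags_disjoint:
  assumes "\<gamma> \<in> front" "\<gamma>' \<in> front" "\<gamma> \<noteq> \<gamma>'" "x \<in> \<Union>(B ` desc \<gamma>')"
  shows "x \<in> \<Union>(B ` (S - desc \<gamma>))"
proof -
  obtain t where t: "t \<in> desc \<gamma>'" "x \<in> B t" using assms(4) by blast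
  then have "t \<in> S - desc \<gamma>" using front_disjoint[OF assms(1,2)] assms(3) by (auto simp: desc_def)
  then show ?thesis using t(2) by blast
qed

text \<open>A vertex that also occurs below another front node lies in the door, at distance 0 from
  it, and is therefore not far.\<close>

lemma far_unique:
  assumes "\<gamma> \<in> front" "\<gamma>' \<in> front" "x \<in> far r \<gamma>" "x \<in> \<Union>(B ` desc \<gamma>')"
  shows "\<gamma> = \<gamma>'"
proof (rule ccontr)
  assume "\<gamma> \<noteq> \<gamma>'"
  then have "x \<in> \<Union>(B ` (S - desc \<gamma>))"
    using front_bags_disjoint assms(1,2,4) by blast
  moreover have "x \<in> \<Union>(B ` desc \<gamma>)" using assms(3) by (simp add: far_def)
  ultimately have "x \<in> dS.nb (2 * r) (door \<gamma>)"
    using nb_door_separation[OF frontD(1)[OF assms(1)] reach_refl] by simp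
  then show False using assms(3) by (simp add: far_def)
qed

definition ring :: "nat \<Rightarrow> 't \<Rightarrow> 'a set" where
  "ring r \<gamma> = {x \<in> \<Union>(B ` desc \<gamma>). x \<in> dS.nb (2 * r) (door \<gamma>) \<and> x \<notin> dS.nb r (door \<gamma>)}"

text \<open>A step of length at most \<open>r\<close> between different rings would cross a door and
  put its start within \<open>r\<close> of it, which rings exclude. So each ring can be treated on
  its own.\<close>

lemma ring_chain_bounded:
  assumes bags: "\<And>t. t \<in> S \<Longrightarrow> finite (B t) \<and> card (B t) \<le> k"
  shows "dS.chain_bounded r (\<Union>(ring r ` front)) (ring_bound k r)"
proof (rule dS.chain_bounded_pieces[of "ring r ` front"])
  fix P assume "P \<in> ring r ` front"
  then obtain \<gamma> where \<gamma>: "\<gamma> \<in> front" "P = ring r \<gamma>" by blast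
  note door_card[OF bags[OF frontD(1)[OF \<gamma>(1)]]]
  moreover have "dS.chain_bounded r (P - dS.nb (2 * r) (door \<gamma>)) 0"
    by (rule dS.chain_bounded_diam) (auto simp: \<gamma> ring_def)
  ultimately show "dS.chain_bounded r P (ring_bound k r)"
    unfolding ring_bound_def by (rule dS.chain_bounded_absorb)
next
  fix P x y assume P: "P \<in> ring r ` front" "x \<in> P" and y: "y \<in> \<Union>(ring r ` front)" and xy: "dS r x y"
  then obtain \<gamma> \<gamma>' where \<gamma>: "\<gamma> \<in> front" "P = ring r \<gamma>" "\<gamma>' \<in> front" "y \<in> ring r \<gamma>'" by blast
  have "\<gamma> = \<gamma>'"
  proof (rule ccontr)
    assume "\<gamma> \<noteq> \<gamma>'"
    then have "y \<in> \<Union>(B ` (S - desc \<gamma>))"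
      using front_bags_disjoint[of \<gamma> \<gamma>' y] \<gamma> by (auto simp: ring_def)
    then have "x \<in> dS.nb r (door \<gamma>)"
      using nb_door_separation[OF frontD(1)[OF \<gamma>(1)] xy] P \<gamma> by (auto simp: ring_def)
    then show False using P \<gamma> by (simp add: ring_def)
  qed
  then show "y \<in> P" using \<gamma> by simp
qed simp

text \<open>Around the door of each front node the colours are forced: \<^const>\<open>False\<close> on the ring just
  above \<open>far\<close>, \<^const>\<open>True\<close> on the first layer of \<open>far\<close>.  Hence no monochromatic chain passes
  from one region to the next.  Inside the region, points within \<open>r\<close> of a door copy the colour
  of a core point nearby.\<close>

lemma good_colouring_extend:
  fixes r k E :: nat and c\<^sub>0 :: "'a \<Rightarrow> bool" and cc :: "'t \<Rightarrow> 'a \<Rightarrow> bool"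
  defines "s \<equiv> body_scale k r" and "D \<equiv> body_bound k r E" and "Bz \<equiv> (\<lambda>t. B t - zone)"
  assumes M: "M = 3 * r"
    and bags: "\<And>t. t \<in> S \<Longrightarrow> finite (B t) \<and> card (B t) \<le> k"
    and core_col: "\<And>i. coarse.chain_bounded (reach R (Bz ` core)) s {x \<in> \<Union>(Bz ` core). c\<^sub>0 x = i} E"
    and front_col: "\<And>\<gamma>. \<gamma> \<in> front \<Longrightarrow> good_colouring r D \<gamma> (cc \<gamma>)"
  shows "\<exists>c. good_colouring r D \<beta> c"
proof -
  interpret dz: coarse "reach R (Bz ` core)" by (rule coarse_reach)
  define V where "V = \<Union>(B ` core)"
  define below where "below = (\<Union>\<gamma>\<in>front. far r \<gamma>)"
  define rings where "rings = \<Union>(ring r ` front)"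
  \<comment> \<open>A core vertex within \<open>r\<close> of \<open>x\<close>; the value matters
    only where one exists, as is shown below for the points of \<open>G i\<close>.\<close>
  define \<pi> where "\<pi> x = (if x \<in> V then x else SOME v. v \<in> V \<and> dS r v x)" for x
  \<comment> \<open>Deep below the front the recursive colourings apply, and rings are
    \<open>False\<close>. Elsewhere a point is \<open>True\<close> if its core representative is
    near the bag of \<open>\<beta>\<close>, and copies \<open>c\<^sub>0\<close> otherwise.\<close>
  define c where "c x = (if x \<in> below then cc (SOME \<gamma>. \<gamma> \<in> front \<and> x \<in> far r \<gamma>) x
    else x \<notin> rings \<and> (\<pi> x \<in> dS.nb (M + s) (B \<beta>) \<or> c\<^sub>0 (\<pi> x)))" for x
  have c_far: "c x = cc \<gamma> x" if "\<gamma> \<in> front" "x \<in> far r \<gamma>" for x \<gamma>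
  proof -
    have "x \<in> \<Union>(B ` desc \<gamma>)" using that by (simp add: far_def)
    then have "(SOME \<gamma>. \<gamma> \<in> front \<and> x \<in> far r \<gamma>) = \<gamma>"
      using that far_unique[OF _ that(1)] by (intro some_equality) blast+
    then show ?thesis using that by (auto simp: c_def below_def)
  qed
  have core_or_front: "x \<in> V \<or> (\<exists>\<gamma>\<in>front. x \<in> \<Union>(B ` desc \<gamma>))" if "x \<in> \<Union>(B ` desc \<beta>)" for x
    using that front_cover unfolding V_def by (metis UN_E UN_I)
  \<comment> \<open>A step out of \<open>far r \<gamma>\<close> either ends in the ring, which is
    \<open>False\<close> while its start is forced to be \<open>True\<close>, or crosses the door,
    to which its start is too far.\<close>
  have stay_far: "y \<in> far r \<gamma>"
    if "\<gamma> \<in> front" "x \<in> far r \<gamma>" "y \<in> far r \<beta>" "c x = c y" "dS r x y" for x y \<gamma>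
  proof (rule ccontr)
    assume far: "y \<notin> far r \<gamma>"
    have x: "x \<in> \<Union>(B ` desc \<gamma>)" "x \<notin> dS.nb (2 * r) (door \<gamma>)" using that by (auto simp: far_def)
    show False
    proof (cases "y \<in> \<Union>(B ` desc \<gamma>)")
      case True
      then have y2: "y \<in> dS.nb (2 * r) (door \<gamma>)" using far by (simp add: far_def)
      have yx: "dS r y x" using that(5) by (rule reach_sym)
      have "y \<notin> dS.nb r (door \<gamma>)"
        using dS.nb_trans[OF _ yx, of r "door \<gamma>"] x(2) by (auto simp: mult_2)
      then have "y \<in> rings" using True y2 that(1) by (auto simp: rings_def ring_def)
      moreover have "y \<notin> below"
        using far_unique[OF _ that(1) _ True] far by (auto simp: below_def)
      ultimately have "\<not> c y" by (simp add: c_def)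
      moreover have "2 * r + r = 3 * r" by simp
      then have "x \<in> dS.nb (3 * r) (door \<gamma>)" using dS.nb_trans[OF y2 yx] by simp
      then have "cc \<gamma> x" using front_col[OF that(1)] that(2) by (auto simp: good_colouring_def)
      ultimately show False using c_far that by simp
    next
      case False
      then have "y \<in> \<Union>(B ` (S - desc \<gamma>))" using that(3) by (auto simp: far_def desc_def)
      then have "x \<in> dS.nb r (door \<gamma>)" using nb_door_separation frontD(1) that(1,5) x(1) by blast
      then show False using x(2) dS.nb_mono[of "door \<gamma>" "door \<gamma>" r "2 * r"] by auto
    qed
  qed
  \<comment> \<open>The radius has an extra \<open>r\<close> so that the representatives stay more
    than \<open>M + s\<close> from the bag of \<open>\<beta>\<close>; on \<open>G i\<close> the
    colour is therefore \<open>c\<^sub>0\<close> of the representative.\<close>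
  define G where "G i = {x \<in> far r \<beta> - below - rings - dS.nb (M + s + r) (B \<beta>). c x = i}" for i
  have \<pi>: "\<pi> x \<in> V" "dS r (\<pi> x) x" "\<pi> x \<notin> dS.nb (M + s) (B \<beta>)" "\<pi> x \<in> \<Union>(Bz ` core)" "c\<^sub>0 (\<pi> x) = i"
    if x: "x \<in> G i" for x i
  proof -
    have "\<pi> x \<in> V \<and> dS r (\<pi> x) x"
    proof (cases "x \<in> V")
      case False
      then obtain \<gamma> where \<gamma>: "\<gamma> \<in> front" "x \<in> \<Union>(B ` desc \<gamma>)"
        using core_or_front x by (auto simp: G_def far_def)
      moreover have "x \<notin> far r \<gamma>" "x \<notin> ring r \<gamma>"
        using x \<gamma>(1) by (auto simp: G_def below_def rings_def)
      ultimately have "x \<in> dS.nb r (door \<gamma>)" by (auto simp: far_def ring_def)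
      then obtain v where "v \<in> door \<gamma>" "dS r v x" by (auto simp: dS.nb_def)
      moreover from this have "v \<in> V" using frontD(4)[OF \<gamma>(1)] by (auto simp: V_def door_def)
      ultimately have "\<exists>v. v \<in> V \<and> dS r v x" by blast
      then show ?thesis using someI_ex[of "\<lambda>v. v \<in> V \<and> dS r v x"] False by (simp add: \<pi>_def)
    qed (simp add: \<pi>_def reach_refl)
    then show *: "\<pi> x \<in> V" "dS r (\<pi> x) x" by blast+
    show **: "\<pi> x \<notin> dS.nb (M + s) (B \<beta>)"
      using dS.nb_trans[OF _ *(2)] x by (auto simp: G_def)
    then have "\<pi> x \<notin> zone"
      using dS.nb_mono[of "B \<beta>" "B \<beta>" M "M + s"] by (auto simp: zone_def)
    then show "\<pi> x \<in> \<Union>(Bz ` core)" using *(1) by (auto simp: V_def Bz_def)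
    show "c\<^sub>0 (\<pi> x) = i" using x ** by (auto simp: G_def c_def)
  qed
  \<comment> \<open>A jump in \<open>G i\<close> becomes a jump of length \<open>s\<close> between
    representatives; \<open>core_convex\<close> puts it into the core and \<open>avoid_zone\<close>
    outside the zone, so the bound for \<open>c\<^sub>0\<close> applies.\<close>
  have G_bounded: "dS.chain_bounded (2 * r + ring_bound k r) (G i) (E + 2 * r)" for i
    unfolding dS.chain_bounded_def
  proof (intro allI impI)
    let ?C = "{x \<in> \<Union>(Bz ` core). c\<^sub>0 x = i}"
    fix x y assume "(x, y) \<in> (dS.link (2 * r + ring_bound k r) (G i))\<^sup>*"
    then have "x = y \<or> (x \<in> G i \<and> y \<in> G i \<and> (\<pi> x, \<pi> y) \<in> (dz.link s ?C)\<^sup>*)"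
    proof induction
      case (step y z)
      then have yz: "y \<in> G i" "z \<in> G i" "dS (2 * r + ring_bound k r) y z" by (auto simp: dS.link_def)
      have "dS (r + (2 * r + ring_bound k r) + r) (\<pi> y) (\<pi> z)"
        by (rule dS.R_trans[OF dS.R_trans[OF \<pi>(2)[OF yz(1)] yz(3)] dS.R_sym[OF \<pi>(2)[OF yz(2)]]])
      moreover have "r + (2 * r + ring_bound k r) + r = s" by (simp add: s_def body_scale_def)
      ultimately have "dS s (\<pi> y) (\<pi> z)" by simp
      then have "reach R (B ` core) s (\<pi> y) (\<pi> z)"
        using core_convex \<pi>(1) yz by (simp add: V_def)
      then have "reach R (Bz ` core) s (\<pi> y) (\<pi> z)"
        unfolding Bz_def using \<pi>(3)[OF yz(1)] by (rule avoid_zone)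
      then have "(\<pi> y, \<pi> z) \<in> dz.link s ?C"
        using \<pi>(4,5) yz by (simp add: dz.link_def)
      then show ?case using step.IH yz by (auto intro: rtrancl_into_rtrancl)
    qed simp
    then show "dS (E + 2 * r) x y"
    proof
      assume xy: "x \<in> G i \<and> y \<in> G i \<and> (\<pi> x, \<pi> y) \<in> (dz.link s ?C)\<^sup>*"
      then have "reach R (Bz ` core) E (\<pi> x) (\<pi> y)" using dz.chain_boundedD[OF core_col] by blast
      then have "dS E (\<pi> x) (\<pi> y)"
        by (rule reach_refine) (use core_subset in \<open>auto simp: Bz_def\<close>)
      then have "dS (r + E + r) x y"
        using \<pi>(2)[of x i] \<pi>(2)[of y i] xy dS.R_trans dS.R_sym by meson
      then show ?thesis by (rule dS.R_mono) simp
    qed (simp add: reach_refl)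
  qed
  have body_bounded: "dS.chain_bounded r {x \<in> far r \<beta> - below. c x = i} D" for i
  proof -
    have "dS.chain_bounded r (G i \<union> rings) (E + 2 * r + 2 * (ring_bound k r + r))"
      using ring_chain_bounded[OF bags] G_bounded unfolding rings_def by (rule dS.chain_bounded_Un)
    then have "dS.chain_bounded r ({x \<in> far r \<beta> - below. c x = i} - dS.nb (M + s + r) (B \<beta>))
        (E + 2 * r + 2 * (ring_bound k r + r))"
      by (rule dS.chain_bounded_mono) (auto simp: G_def)
    then show ?thesis
      unfolding D_def body_bound_def s_def M using bags[OF top]
      by (intro dS.chain_bounded_absorb[of "B \<beta>"]) auto
  qed
  \<comment> \<open>The pieces are the body and one set for each front node. By
    \<open>stay_far\<close> no monochromatic step joins different pieces, so the bound
    \<open>D\<close> of the front colourings is preserved.\<close>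
  have "dS.chain_bounded r {x \<in> far r \<beta>. c x = i} D" for i
  proof (rule dS.chain_bounded_pieces)
    let ?P = "insert {x \<in> far r \<beta> - below. c x = i}
      ((\<lambda>\<gamma>. {x \<in> far r \<beta> \<inter> far r \<gamma>. c x = i}) ` front)"
    show "{x \<in> far r \<beta>. c x = i} \<subseteq> \<Union>?P" by (auto simp: below_def)
    fix P assume P: "P \<in> ?P"
    show "dS.chain_bounded r P D"
    proof (cases "P = {x \<in> far r \<beta> - below. c x = i}")
      case True
      show ?thesis unfolding True by (rule body_bounded)
    next
      case False
      then obtain \<gamma> where \<gamma>: "\<gamma> \<in> front" "P = {x \<in> far r \<beta> \<inter> far r \<gamma>. c x = i}" using P by blast
      have "dS.chain_bounded r {x \<in> far r \<gamma>. cc \<gamma> x = i} D"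
        using front_col[OF \<gamma>(1)] by (simp add: good_colouring_def)
      then show ?thesis by (rule dS.chain_bounded_mono) (use \<gamma> c_far in auto)
    qed
    fix x y assume xy: "x \<in> P" "x \<in> {x \<in> far r \<beta>. c x = i}" "y \<in> {x \<in> far r \<beta>. c x = i}" "dS r x y"
    then have yx: "c x = c y" "c y = c x" "dS r y x" by (auto intro: reach_sym)
    show "y \<in> P"
    proof (cases "P = {x \<in> far r \<beta> - below. c x = i}")
      case True
      have "y \<notin> below"
        using stay_far[OF _ _ _ yx(2,3)] xy(1,2) True by (auto simp: below_def)
      then show ?thesis using True xy(3) by simp
    next
      case False
      then obtain \<gamma> where \<gamma>: "\<gamma> \<in> front" "P = {x \<in> far r \<beta> \<inter> far r \<gamma>. c x = i}" using P by blast
      then show ?thesis using stay_far[OF \<gamma>(1) _ _ yx(1) xy(4)] xy by simp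
    qed
  qed
  \<comment> \<open>This clause explains \<open>M = 3 * r\<close>: if \<open>x\<close> were below a
    front node, a walk from \<open>x\<close> to the bag of \<open>\<beta>\<close> would cross the
    door of that node within \<open>3 * r\<close> of the bag, and front bags avoid the zone.\<close>
  moreover have "c x" if x: "x \<in> far r \<beta> \<inter> dS.nb (3 * r) (door \<beta>)" for x
  proof -
    obtain a where a: "a \<in> B \<beta>" "dS (3 * r) a x"
      using x door_subset by (auto simp: dS.nb_def)
    have no_front: "x \<notin> \<Union>(B ` desc \<gamma>)" if \<gamma>: "\<gamma> \<in> front" for \<gamma>
    proof
      assume "x \<in> \<Union>(B ` desc \<gamma>)"
      moreover have "a \<in> \<Union>(B ` (S - desc \<gamma>))" using a(1) frontD(6)[OF \<gamma>] top by blast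
      ultimately obtain b where b: "b \<in> door \<gamma>" "dS (3 * r) b a"
        by (rule separation[OF frontD(1)[OF \<gamma>] reach_sym[OF a(2)]])
      have "b \<in> zone" unfolding zone_def unfolding dS.nb_def M using a(1) reach_sym[OF b(2)] by blast
      then show False using b(1) door_subset[of \<gamma>] frontD(3)[OF \<gamma>] by blast
    qed
    then have "x \<notin> below" "x \<notin> rings"
      by (auto simp: below_def rings_def far_def ring_def)
    moreover have "x \<in> V" using x core_or_front no_front by (auto simp: far_def)
    moreover have "x \<in> dS.nb (M + s) (B \<beta>)"
      using a dS.nb_mono[of "B \<beta>" "B \<beta>" "3 * r" "M + s"] M by (auto simp: dS.nb_def)
    ultimately show ?thesis by (simp add: c_def \<pi>_def)
  qed
  ultimately show ?thesis unfolding good_colouring_def by blast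
qed

end

context rooted_bags
begin

text \<open>Induction on the number of nodes below \<open>\<beta>\<close>, with the induction on bag
  size supplied as \<open>IH\<close>. Extending the front colourings does not increase the bound, so
  it is independent of the depth of the tree.\<close>

lemma good_colouring_exists:
  fixes r k :: nat
  defines "s \<equiv> body_scale (Suc k) r"
  assumes IH: "\<And>S' \<rho>' B'. rooted_bags R p rk S' \<rho>' B' \<Longrightarrow>
      (\<And>t. t \<in> S' \<Longrightarrow> finite (B' t) \<and> card (B' t) \<le> k) \<Longrightarrow>
      \<exists>c :: 'a \<Rightarrow> bool. \<forall>i. coarse.chain_bounded (reach R (B' ` S')) s {x \<in> \<Union>(B' ` S'). c x = i} E"
    and bags: "\<And>t. t \<in> S \<Longrightarrow> finite (B t) \<and> card (B t) \<le> Suc k"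
    and "\<beta> \<in> S"
  shows "\<exists>c. good_colouring r (body_bound (Suc k) r E) \<beta> c"
  using \<open>\<beta> \<in> S\<close>
proof (induction "card (desc \<beta>)" arbitrary: \<beta> rule: less_induct)
  case less
  interpret region R p rk S \<rho> B \<beta> "3 * r" by unfold_locales (rule less.prems)
  have small: "finite (B t - zone) \<and> card (B t - zone) \<le> k" if "t \<in> core" for t
  proof (cases "B t = {}")
    case False
    have fin: "finite (B t)" "card (B t) \<le> Suc k" using bags[OF coreD(1)[OF that]] by auto
    have "B t - zone \<subset> B t" using core_bag_zone[OF that False] by blast
    then have "card (B t - zone) < card (B t)" by (rule psubset_card_mono[OF fin(1)])
    then show ?thesis using fin by simp
  qed simp
  have "\<exists>c :: 'a \<Rightarrow> bool. \<forall>i. coarse.chain_bounded (reach R ((\<lambda>t. B t - zone) ` core)) s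
      {x \<in> \<Union>((\<lambda>t. B t - zone) ` core). c x = i} E"
    by (rule IH[OF core_rooted]) (rule small)
  then obtain c\<^sub>0 :: "'a \<Rightarrow> bool" where c\<^sub>0: "coarse.chain_bounded (reach R ((\<lambda>t. B t - zone) ` core)) s
      {x \<in> \<Union>((\<lambda>t. B t - zone) ` core). c\<^sub>0 x = i} E" for i
    by blast
  have "\<exists>c. good_colouring r (body_bound (Suc k) r E) \<gamma> c" if "\<gamma> \<in> front" for \<gamma>
  proof (rule less.hyps)
    have "\<beta> \<in> desc \<beta>" using less.prems anc_refl by (simp add: desc_def)
    then have "desc \<gamma> \<subset> desc \<beta>" using frontD(5,6)[OF that] by blast
    moreover have "finite (desc \<beta>)" using finite_nodes by (simp add: desc_def)
    ultimately show "card (desc \<gamma>) < card (desc \<beta>)" by (rule psubset_card_mono[rotated])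
    show "\<gamma> \<in> S" using that by (rule frontD)
  qed
  then obtain cc where "\<And>\<gamma>. \<gamma> \<in> front \<Longrightarrow> good_colouring r (body_bound (Suc k) r E) \<gamma> (cc \<gamma>)"
    by metis
  then show ?case
    using good_colouring_extend[OF refl bags c\<^sub>0[unfolded s_def]] by blast
qed

end

text \<open>Induction on the bag size with \<open>r\<close> arbitrary, because smaller bags are
  coloured at the larger scale \<open>body_scale (Suc k) r\<close>.\<close>

theorem bounded_colouring:
  fixes B :: "'t \<Rightarrow> 'a set"
  assumes "rooted_bags R p rk S \<rho> B"
    and "\<And>t. t \<in> S \<Longrightarrow> finite (B t) \<and> card (B t) \<le> k"
  shows "\<exists>c :: 'a \<Rightarrow> bool. \<forall>i. coarse.chain_bounded (reach R (B ` S)) r {x \<in> \<Union>(B ` S). c x = i}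
    (colour_bound k r)"
  using assms
proof (induction k arbitrary: S \<rho> B r)
  case 0
  interpret rooted_bags R p rk S \<rho> B by fact
  have empty: "\<Union>(B ` S) = {}" using "0.prems"(2) by fastforce
  have "dS.chain_bounded r {x \<in> \<Union>(B ` S). c x = i} (colour_bound 0 r)" for c :: "'a \<Rightarrow> bool" and i
    by (rule dS.chain_bounded_diam) (use empty in blast)
  then show ?case by blast
next
  case (Suc k)
  interpret rooted_bags R p rk S \<rho> B by fact
  let ?E = "colour_bound k (body_scale (Suc k) r)"
  have "\<exists>c. good_colouring r (body_bound (Suc k) r ?E) \<rho> c"
  proof (rule good_colouring_exists[OF _ _ root])
    show "\<exists>c :: 'a \<Rightarrow> bool. \<forall>i. coarse.chain_bounded (reach R (B' ` S')) (body_scale (Suc k) r)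
        {x \<in> \<Union>(B' ` S'). c x = i} ?E"
      if "rooted_bags R p rk S' \<rho>' B'" "\<And>t. t \<in> S' \<Longrightarrow> finite (B' t) \<and> card (B' t) \<le> k"
      for S' \<rho>' and B' :: "'t \<Rightarrow> 'a set"
      using that by (rule Suc.IH)
  qed (rule Suc.prems(2))
  then obtain c where c: "good_colouring r (body_bound (Suc k) r ?E) \<rho> c" ..
  have desc: "desc \<rho> = S" using below_root by (auto simp: desc_def)
  have "dS.chain_bounded r {x \<in> \<Union>(B ` S). c x = i} (colour_bound (Suc k) r)" for i
  proof -
    \<comment> \<open>A good colouring controls nothing within \<open>2 * r\<close> of the root
      door; that neighbourhood is absorbed.\<close>
    have "dS.chain_bounded r {x \<in> far r \<rho>. c x = i} (body_bound (Suc k) r ?E)"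
      using c by (simp add: good_colouring_def)
    then have "dS.chain_bounded r ({x \<in> \<Union>(B ` S). c x = i} - dS.nb (2 * r) (door \<rho>))
        (body_bound (Suc k) r ?E)"
      by (rule dS.chain_bounded_mono) (auto simp: far_def desc)
    with door_card[OF Suc.prems(2)[OF root]] show ?thesis
      unfolding colour_bound.simps by (rule dS.chain_bounded_absorb)
  qed
  then show ?case by blast
qed

section \<open>Graphs and their tree decompositions\<close>

text \<open>The relation \<open>d(u, v) \<le> n\<close>; the power 0 makes it reflexive on the whole
  type, as \<open>coarse\<close> demands.\<close>

definition near :: "'a pair_pre_digraph \<Rightarrow> nat \<Rightarrow> 'a \<Rightarrow> 'a \<Rightarrow> bool" where
  "near G n u v \<longleftrightarrow> (\<exists>m\<le>n. (u, v) \<in> parcs G ^^ m)"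

lemma nearI_arc: "(u, v) \<in> parcs G \<Longrightarrow> near G 1 u v"
  unfolding near_def by (rule exI[of _ 1]) simp

lemma sym_relpow:
  assumes "sym r"
  shows "sym (r ^^ n)"
proof (induction n)
  case (Suc n)
  show ?case
  proof (rule symI)
    fix x y assume "(x, y) \<in> r ^^ Suc n"
    then obtain z where "(x, z) \<in> r ^^ n" "(z, y) \<in> r" by auto
    then have "(y, z) \<in> r" "(z, x) \<in> r ^^ n" using Suc.IH assms by (blast dest: symD)+
    then show "(y, x) \<in> r ^^ Suc n" by (rule relpow_Suc_I2)
  qed
qed (simp add: sym_def)

context pair_graph
begin

lemma sym_parcs: "sym (parcs G)"
  using arcs_symmetric by (auto intro: symI)

lemma coarse_near: "coarse (near G)"
proof
  fix n x show "near G n x x" unfolding near_def by (rule exI[of _ 0]) simp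
next
  fix n x y assume "near G n x y"
  then show "near G n y x" using sym_relpow[OF sym_parcs] unfolding near_def by (blast dest: symD)
next
  fix m n x y z assume "near G m x y" "near G n y z"
  then obtain i j where "i \<le> m" "(x, y) \<in> parcs G ^^ i" "j \<le> n" "(y, z) \<in> parcs G ^^ j"
    by (auto simp: near_def)
  then have "i + j \<le> m + n" "(x, z) \<in> parcs G ^^ (i + j)" by (auto simp: relpow_add)
  then show "near G (m + n) x z" unfolding near_def by blast
qed

lemma awalk_relpow: "awalk u q v \<Longrightarrow> (u, v) \<in> parcs G ^^ length q"
proof (induction q arbitrary: u)
  case (Cons e q)
  then have "(u, snd e) \<in> parcs G" "(snd e, v) \<in> parcs G ^^ length q"
    by (auto simp: awalk_Cons_iff)
  then show ?case unfolding length_Cons by (rule relpow_Suc_I2)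
qed (simp add: awalk_Nil_iff)

lemma relpow_awalk:
  "(u, v) \<in> parcs G ^^ m \<Longrightarrow> u \<in> pverts G \<Longrightarrow> \<exists>q. awalk u q v \<and> length q = m"
proof (induction m arbitrary: u)
  case 0
  then show ?case by (simp add: awalk_Nil_iff)
next
  case (Suc m)
  then obtain x where x: "(u, x) \<in> parcs G" "(x, v) \<in> parcs G ^^ m" by (metis relpow_Suc_D2)
  then obtain q where "awalk x q v" "length q = m" using Suc.IH in_arcsD2 by blast
  then have "awalk u ((u, x) # q) v" "length ((u, x) # q) = Suc m"
    using x Suc.prems by (auto simp: awalk_Cons_iff)
  then show ?case by blast
qed

lemma awalk_cost_unit: "awalk_cost (\<lambda>_. 1) q = real (length q)"
  by (induction q) auto

lemma near_imp_dist:
  assumes "near G n u v" "u \<in> pverts G"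
  shows "graph_dist G u v \<le> ereal n"
proof -
  obtain q where q: "awalk u q v" "length q \<le> n"
    using assms relpow_awalk unfolding near_def by metis
  have "graph_dist G u v \<le> ereal (awalk_cost (\<lambda>_. 1) q)"
    unfolding graph_dist_def using q(1) by (rule min_cost_le_walk_cost)
  also have "\<dots> \<le> ereal n" using q(2) by (simp add: awalk_cost_unit)
  finally show ?thesis .
qed

lemma dist_imp_near:
  assumes "graph_dist G u v \<le> ereal r" "r > 0"
  shows "near G (nat \<lceil>r\<rceil>) u v"
proof -
  \<comment> \<open>Strictness yields an actual walk below the infimum bound; its length is an
    integer less than \<open>r + 1\<close>, hence at most the ceiling of \<open>r\<close>.\<close>
  have "(INF q\<in>{q. awalk u q v}. ereal (awalk_cost (\<lambda>_. 1) q)) < ereal (r + 1)"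
    using assms(1) unfolding graph_dist_def \<mu>_def by (rule le_less_trans) simp
  then obtain q where q: "awalk u q v" "real (length q) < r + 1"
    by (auto simp: INF_less_iff awalk_cost_unit)
  then have "length q \<le> nat \<lceil>r\<rceil>" using assms(2) by linarith
  then show ?thesis using awalk_relpow[OF q(1)] unfolding near_def by blast
qed

end

section \<open>Rooting a tree and its decomposition\<close>

lemma connected_rtrancl:
  assumes "Digraph_Component.connected H" "u \<in> verts H" "v \<in> verts H"
  shows "(u, v) \<in> (parcs (mk_symmetric H))\<^sup>*"
proof -
  have "u \<rightarrow>\<^sup>*\<^bsub>mk_symmetric H\<^esub> v"
    using assms by (auto simp: Digraph_Component.connected_def strongly_connected_def)
  from reachable_rtranclI[OF this] show ?thesis by simp
qed

text \<open>The parent of a node is a neighbour closer to \<open>\<rho>\<close>. An edge that joins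
  no node to its parent would close a cycle with parent edges.\<close>

lemma rooted_tree:
  fixes T :: "'t pair_pre_digraph"
  assumes "undirected_tree T"
  shows "\<exists>\<rho> p (rk :: 't \<Rightarrow> nat). \<rho> \<in> pverts T \<and> (\<forall>t. p t = t \<or> rk (p t) < rk t) \<and>
    (\<forall>t\<in>pverts T. anc p \<rho> t \<and> (t \<noteq> \<rho> \<longrightarrow> p t \<in> pverts T)) \<and>
    (\<forall>a b. (a, b) \<in> parcs T \<longrightarrow> p a = b \<or> p b = a)"
proof -
  interpret pair_graph T using assms by (simp add: undirected_tree_def)
  have con: "Digraph_Component.connected (with_proj T)"
    and acyclic: "\<And>q. cycle q \<Longrightarrow> length q < 3"
    using assms by (auto simp: undirected_tree_def not_le)
  obtain \<rho> where \<rho>: "\<rho> \<in> pverts T"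
    using con by (auto simp: Digraph_Component.connected_def strongly_connected_def)
  have sym_arcs: "parcs (mk_symmetric T) = parcs T"
    using arcs_symmetric by (auto simp: parcs_mk_symmetric)
  define rk where "rk t = (LEAST n. (\<rho>, t) \<in> parcs T ^^ n)" for t
  have closer: "\<exists>u. (u, t) \<in> parcs T \<and> rk u < rk t" if t: "t \<in> pverts T" "t \<noteq> \<rho>" for t
  proof -
    have "(\<rho>, t) \<in> (parcs T)\<^sup>*" using connected_rtrancl[OF con, of \<rho> t] \<rho> t sym_arcs by simp
    then have "\<exists>n. (\<rho>, t) \<in> parcs T ^^ n" by (rule rtrancl_imp_relpow)
    then have path: "(\<rho>, t) \<in> parcs T ^^ rk t" unfolding rk_def by (rule LeastI_ex)
    then obtain m where m: "rk t = Suc m" using t(2) by (cases "rk t") auto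
    then obtain u where "(\<rho>, u) \<in> parcs T ^^ m" "(u, t) \<in> parcs T" using path by auto
    moreover from this have "rk u \<le> m" unfolding rk_def by (intro Least_le)
    ultimately show ?thesis using m by auto
  qed
  define p where "p t = (if t \<in> pverts T \<and> t \<noteq> \<rho> then SOME u. (u, t) \<in> parcs T \<and> rk u < rk t else t)"
    for t
  have p: "(p t, t) \<in> parcs T" "rk (p t) < rk t" if "t \<in> pverts T" "t \<noteq> \<rho>" for t
    using someI_ex[OF closer[OF that]] that by (simp_all add: p_def)
  have step: "p t \<in> pverts T" if "t \<in> pverts T" "t \<noteq> \<rho>" for t
    using p(1)[OF that] by (rule in_arcsD1)
  have "anc p \<rho> t" if "t \<in> pverts T" for t
    using that
  proof (induction "rk t" arbitrary: t rule: less_induct)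
    case less
    show ?case
    proof (cases "t = \<rho>")
      case False
      then have "anc p \<rho> (p t)" using less p(2) step by blast
      then show ?thesis using anc_parent anc_trans by metis
    qed (simp add: anc_refl)
  qed
  moreover have "p a = b \<or> p b = a" if ab: "(a, b) \<in> parcs T" for a b
  proof (rule ccontr)
    assume np: "\<not> (p a = b \<or> p b = a)"
    \<comment> \<open>All parent edges survive the removal of this edge, so \<open>a\<close> and
      \<open>b\<close> are still joined through \<open>\<rho>\<close>; a path from \<open>b\<close>
      to \<open>a\<close> in \<open>E\<close> closes a cycle with \<open>(a, b)\<close>.\<close>
    define E where "E = parcs T - {(a, b), (b, a)}"
    define T' where "T' = \<lparr>pverts = pverts T, parcs = E\<rparr>"
    interpret T': pair_wf_digraph T'
      by unfold_locales (auto simp: T'_def E_def arc_fst_in_verts arc_snd_in_verts)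
    have symE: "sym E" using sym_parcs by (auto simp: E_def sym_def)
    have to_root: "(t, \<rho>) \<in> E\<^sup>*" if "t \<in> pverts T" for t
      using that
    proof (induction "rk t" arbitrary: t rule: less_induct)
      case less
      show ?case
      proof (cases "t = \<rho>")
        case False
        then have "(p t, t) \<in> E" using p(1)[OF less.prems] np by (auto simp: E_def)
        then have "(t, p t) \<in> E" using symE by (rule symD[rotated])
        moreover have "(p t, \<rho>) \<in> E\<^sup>*"
          using less.hyps[OF p(2) step] less.prems False by blast
        ultimately show ?thesis by (rule converse_rtrancl_into_rtrancl)
      qed simp
    qed
    have verts: "a \<in> pverts T" "b \<in> pverts T" using ab in_arcsD1 in_arcsD2 by auto
    have "a \<noteq> b" using ab by (rule no_loops')
    have "(\<rho>, a) \<in> E\<^sup>*" using to_root[OF verts(1)] sym_rtrancl[OF symE] by (meson symD)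
    with to_root[OF verts(2)] have "(b, a) \<in> E\<^sup>*" by (rule rtrancl_trans)
    then have "(b, a) \<in> (parcs T')\<^sup>+" using \<open>a \<noteq> b\<close> by (auto simp: T'_def rtrancl_eq_or_trancl)
    then have "b \<rightarrow>\<^sup>*\<^bsub>T'\<^esub> a" by (simp add: T'.reachable1_reachable)
    then obtain q where q: "T'.apath b q a" by (auto simp: T'.reachable_apath)
    have "parcs T' = E" by (simp add: T'_def)
    then have qE: "set q \<subseteq> E" "pcas b q a" "distinct (pawalk_verts b q)"
      using q by (auto simp: T'.apath_def T'.awalk_def)
    then have walk: "awalk a ((a, b) # q) a" using ab verts by (auto simp: awalk_def E_def)
    moreover have "distinct (tl (pawalk_verts a ((a, b) # q)))" using qE by simp
    ultimately have "cycle ((a, b) # q)" unfolding cycle_def by (metis awalk_verts_with_proj_eq list.discI)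
    \<comment> \<open>A cycle of length below 3 leaves only the path consisting of the reverse arc
      \<open>(b, a)\<close>, which \<open>E\<close> does not contain.\<close>
    then have "length q < 2" using acyclic by force
    moreover have "q \<noteq> []" using qE(2) \<open>a \<noteq> b\<close> by auto
    ultimately obtain e where "q = [e]" by (cases q) auto
    then have "e = (b, a)" "e \<in> E" using qE by (auto simp: prod_eq_iff)
    then show False by (simp add: E_def)
  qed
  moreover have "p t = t \<or> rk (p t) < rk t" for t using p(2) by (auto simp: p_def)
  ultimately show ?thesis using \<rho> step by blast
qed

lemma (in pair_graph) rooted_tree_decomposition:
  fixes T :: "'t pair_pre_digraph"
  assumes "tree_decomposition G T \<beta>"
  obtains p rk \<rho> where "rooted_bags (near G) p rk (pverts T) \<rho> \<beta>"
proof -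
  have tree: "undirected_tree T" and bags: "(\<Union>t\<in>pverts T. \<beta> t) = pverts G"
    and con: "\<And>v. v \<in> pverts G \<Longrightarrow>
      Digraph_Component.connected (with_proj T \<restriction> {t \<in> pverts T. v \<in> \<beta> t})"
    using assms by (auto simp: tree_decomposition_def)
  interpret T: pair_graph T using tree by (simp add: undirected_tree_def)
  interpret coarse "near G" by (rule coarse_near)
  obtain \<rho> p and rk :: "'t \<Rightarrow> nat" where
    root: "\<rho> \<in> pverts T" and rank: "\<And>t. p t = t \<or> rk (p t) < rk t"
    and below: "\<And>t. t \<in> pverts T \<Longrightarrow> anc p \<rho> t"
    and parent: "\<And>t. t \<in> pverts T \<Longrightarrow> t \<noteq> \<rho> \<Longrightarrow> p t \<in> pverts T"
    and arcs: "\<And>a b. (a, b) \<in> parcs T \<Longrightarrow> p a = b \<or> p b = a"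
    using rooted_tree[OF tree] by blast
  have "rooted_bags (near G) p rk (pverts T) \<rho> \<beta>"
  proof unfold_locales
    show "finite (pverts T)" by (rule T.pair_finite_verts)
    fix \<gamma> t t' v assume nodes: "t \<in> pverts T" "t' \<in> pverts T" and anc: "anc p \<gamma> t" "\<not> anc p \<gamma> t'"
      and v: "v \<in> \<beta> t" "v \<in> \<beta> t'"
    let ?X = "{t \<in> pverts T. v \<in> \<beta> t}"
    have "v \<in> pverts G" using bags nodes v by blast
    from connected_rtrancl[OF con[OF this], of t t']
    have "(t, t') \<in> (parcs (mk_symmetric (with_proj T \<restriction> ?X)))\<^sup>*" using nodes v by simp
    \<comment> \<open>Following a path through nodes containing \<open>v\<close>, one leaves the
      nodes below \<open>\<gamma>\<close> only from \<open>\<gamma>\<close> to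
      \<open>p \<gamma>\<close>, and then both bags contain \<open>v\<close>.\<close>
    then have "anc p \<gamma> t' \<or> v \<in> \<beta> \<gamma> \<inter> \<beta> (p \<gamma>)"
    proof induction
      case (step s s')
      then have ss: "(s, s') \<in> parcs T \<or> (s', s) \<in> parcs T" "v \<in> \<beta> s" "v \<in> \<beta> s'"
        by (auto simp: parcs_mk_symmetric)
      then consider "p s = s'" | "p s' = s" using arcs by blast
      then show ?case
      proof cases
        case 1
        then show ?thesis using step.IH ss anc_step[of p \<gamma> s] by auto
      next
        case 2
        then show ?thesis using step.IH anc_trans[OF _ anc_parent[of p s'], of \<gamma>] by auto
      qed
    qed (simp add: anc)
    then show "v \<in> \<beta> \<gamma> \<inter> \<beta> (p \<gamma>)" using anc by simp
  qed (fact root rank below parent)+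
  then show thesis by (rule that)
qed

text \<open>Each edge lies in a bag, so a graph walk is a walk through bags. Together with
  \<open>reach_imp_R\<close> this identifies the two metrics.\<close>

lemma (in pair_graph) near_imp_reach:
  assumes "tree_decomposition G T \<beta>" "near G n u v"
  shows "reach (near G) (\<beta> ` pverts T) n u v"
proof -
  interpret coarse "near G" by (rule coarse_near)
  obtain m where m: "m \<le> n" "(u, v) \<in> parcs G ^^ m" using assms(2) by (auto simp: near_def)
  have "reach (near G) (\<beta> ` pverts T) m u v"
    using m(2)
  proof (induction m arbitrary: v)
    case 0
    then show ?case by (simp add: reach_refl)
  next
    case (Suc m)
    then obtain x where x: "reach (near G) (\<beta> ` pverts T) m u x" "(x, v) \<in> parcs G" by auto
    moreover from this obtain t where "t \<in> pverts T" "x \<in> \<beta> t" "v \<in> \<beta> t"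
      using assms(1) by (auto simp: tree_decomposition_def)
    ultimately have "reach (near G) (\<beta> ` pverts T) (m + 1) u v"
      using reach_step_image[OF x(1)] nearI_arc by metis
    then show ?case by simp
  qed
  then show ?thesis using m(1) by (rule reach_mono)
qed

section \<open>Decompositions attaining the treewidth\<close>

lemma connected_singleton: "verts H = {a} \<Longrightarrow> Digraph_Component.connected H"
  unfolding Digraph_Component.connected_def
  by (rule strongly_connectedI) (auto simp: reachable_def intro: rtrancl_on_refl)

text \<open>\<open>LEAST\<close> over the integers denotes a minimum only if one exists; widths are
  bounded below by -1, and some decomposition exists.\<close>

lemma treewidth_decomposition:
  assumes "pair_graph G"
  obtains T :: "nat pair_pre_digraph" and \<beta>
    where "tree_decomposition G T \<beta>" "decomposition_width T \<beta> = treewidth G"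
proof -
  interpret pair_graph G by fact
  define P where "P k \<longleftrightarrow> (\<exists>(T :: nat pair_pre_digraph) \<beta>.
     tree_decomposition G T \<beta> \<and> decomposition_width T \<beta> = k)" for k
  have lower: "-1 \<le> k" if k: "P k" for k
  proof -
    obtain T :: "nat pair_pre_digraph" and \<beta> where T: "tree_decomposition G T \<beta>"
      "decomposition_width T \<beta> = k" using k by (auto simp: P_def)
    then have tree: "undirected_tree T" by (simp add: tree_decomposition_def)
    then interpret T: pair_graph T by (simp add: undirected_tree_def)
    obtain t where "t \<in> pverts T" using rooted_tree[OF tree] by blast
    then have "int (card (\<beta> t)) \<le> Max ((\<lambda>t. int (card (\<beta> t))) ` pverts T)"
      by (intro Max_ge) (auto simp: T.pair_finite_verts)
    then show ?thesis using T(2) by (simp add: decomposition_width_def)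
  qed
  \<comment> \<open>The one-node tree with the whole vertex set as its bag.\<close>
  define T\<^sub>0 where "T\<^sub>0 = \<lparr>pverts = {0 :: nat}, parcs = {}\<rparr>"
  interpret T\<^sub>0: pair_graph T\<^sub>0 by unfold_locales (auto simp: T\<^sub>0_def symmetric_def sym_def)
  have "undirected_tree T\<^sub>0"
    unfolding undirected_tree_def
  proof (intro conjI notI)
    show "pair_graph T\<^sub>0" ..
    show "Digraph_Component.connected (with_proj T\<^sub>0)"
      by (rule connected_singleton) (simp add: T\<^sub>0_def)
    assume "\<exists>q. T\<^sub>0.cycle q \<and> 3 \<le> length q"
    then obtain q where "T\<^sub>0.cycle q" by blast
    moreover have "parcs T\<^sub>0 = {}" by (simp add: T\<^sub>0_def)
    ultimately show False by (auto simp: T\<^sub>0.cycle_def T\<^sub>0.awalk_def)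
  qed
  moreover have "Digraph_Component.connected (with_proj T\<^sub>0 \<restriction> {t \<in> pverts T\<^sub>0. v \<in> pverts G})"
    if "v \<in> pverts G" for v
    by (rule connected_singleton[of _ 0]) (use that in \<open>auto simp: T\<^sub>0_def\<close>)
  ultimately have "tree_decomposition G T\<^sub>0 (\<lambda>_. pverts G)"
    unfolding tree_decomposition_def by (auto simp: T\<^sub>0_def wellformed')
  then have "\<exists>k. P k" unfolding P_def by blast
  then obtain k where "P k" by blast
  \<comment> \<open>Shifting by 1 makes all widths natural numbers, where least elements
    exist.\<close>
  then have "P (int (nat (k + 1)) - 1)" using lower[of k] by simp
  then obtain n where n: "P (int n - 1)" "\<And>m. P (int m - 1) \<Longrightarrow> n \<le> m"
    using ex_has_least_nat[of "\<lambda>n. P (int n - 1)" "nat (k + 1)" "\<lambda>n. n"] by blast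
  have "treewidth G = int n - 1"
    unfolding treewidth_def P_def[symmetric]
  proof (rule Least_equality)
    fix k assume "P k"
    then have "P (int (nat (k + 1)) - 1)" using lower[of k] by simp
    then have "n \<le> nat (k + 1)" by (rule n(2))
    then show "int n - 1 \<le> k" using lower[OF \<open>P k\<close>] by simp
  qed (rule n(1))
  then show thesis using n(1) that unfolding P_def by metis
qed

section \<open>Covers from colourings\<close>

lemma (in coarse) sym_link: "sym (link n S)"
  using R_sym by (auto simp: link_def sym_def)

text \<open>Each family consists of the chain components of one colour class, at the scale of
  \<open>r\<close> rounded up. Bags have at most \<open>Suc w\<close> vertices.\<close>

lemma bounded_treewidth_cover:
  fixes G :: "'a pair_pre_digraph"
  assumes "pair_graph G" "treewidth G \<le> int w" "r > 0"
  shows "\<exists>\<U> :: nat \<Rightarrow> 'a set set.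
      \<Union>(\<Union>i\<in>{1..1+1}. \<U> i) = pverts G \<and>
      (\<forall>i\<in>{1..1+1}. disjoint_family_at_scale (graph_dist G) r (\<U> i)) \<and>
      bounded_family (graph_dist G) (real (colour_bound (Suc w) (nat \<lceil>r\<rceil>)) + 1) (\<Union>i\<in>{1..1+1}. \<U> i)"
proof -
  interpret pair_graph G by fact
  define n where "n = nat \<lceil>r\<rceil>"
  obtain T :: "nat pair_pre_digraph" and \<beta> where T: "tree_decomposition G T \<beta>"
    "decomposition_width T \<beta> = treewidth G" by (rule treewidth_decomposition[OF assms(1)])
  have verts: "\<Union>(\<beta> ` pverts T) = pverts G" using T(1) by (simp add: tree_decomposition_def)
  interpret T: pair_graph T using T(1) by (simp add: tree_decomposition_def undirected_tree_def)
  obtain p rk \<rho> where "rooted_bags (near G) p rk (pverts T) \<rho> \<beta>"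
    using T(1) by (rule rooted_tree_decomposition)
  then interpret rooted_bags "near G" p rk "pverts T" \<rho> \<beta> .
  have "finite (\<beta> t) \<and> card (\<beta> t) \<le> Suc w" if "t \<in> pverts T" for t
  proof
    show "finite (\<beta> t)" using verts that pair_finite_verts by (metis UN_upper finite_subset)
    have "int (card (\<beta> t)) \<le> Max ((\<lambda>t. int (card (\<beta> t))) ` pverts T)"
      using that by (intro Max_ge) (auto simp: T.pair_finite_verts)
    then show "card (\<beta> t) \<le> Suc w" using T(2) assms(2) by (simp add: decomposition_width_def)
  qed
  then have "\<exists>c :: 'a \<Rightarrow> bool. \<forall>i. dS.chain_bounded n {x \<in> \<Union>(\<beta> ` pverts T). c x = i}
      (colour_bound (Suc w) n)"
    by (rule bounded_colouring[OF rooted_bags_axioms])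
  then obtain c :: "'a \<Rightarrow> bool" where c: "\<And>i. dS.chain_bounded n {x \<in> pverts G. c x = i} (colour_bound (Suc w) n)"
    unfolding verts by blast
  \<comment> \<open>Index 1 selects the colour \<open>True\<close> and index 2 the colour
    \<open>False\<close>.\<close>
  define X where "X i = {x \<in> pverts G. c x = (i = (1 :: nat))}" for i
  define L where "L i = (dS.link n (X i))\<^sup>*" for i
  define \<U> where "\<U> i = (\<lambda>x. L i `` {x}) ` X i" for i
  have symL: "sym (L i)" for i unfolding L_def by (rule sym_rtrancl[OF dS.sym_link])
  have transL: "trans (L i)" for i unfolding L_def by (rule trans_rtrancl)
  have inX: "y \<in> X i" if "(x, y) \<in> L i" "x \<in> X i" for x y i
    using that unfolding L_def by induction (auto simp: dS.link_def)
  have "\<Union>(\<Union>i\<in>{1..1+1}. \<U> i) = pverts G"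
  proof
    show "\<Union>(\<Union>i\<in>{1..1+1}. \<U> i) \<subseteq> pverts G" using inX by (auto simp: \<U>_def X_def)
    show "pverts G \<subseteq> \<Union>(\<Union>i\<in>{1..1+1}. \<U> i)"
    proof
      fix x assume x: "x \<in> pverts G"
      define i :: nat where "i = (if c x then 1 else 2)"
      have "x \<in> X i" "i \<in> {1..1+1}" using x by (auto simp: X_def i_def)
      moreover have "x \<in> L i `` {x}" by (simp add: L_def)
      ultimately show "x \<in> \<Union>(\<Union>i\<in>{1..1+1}. \<U> i)" unfolding \<U>_def by blast
    qed
  qed
  moreover have "disjoint_family_at_scale (graph_dist G) r (\<U> i)" for i
    unfolding disjoint_family_at_scale_def
  proof (intro ballI impI, rule ccontr)
    fix A B a b assume AB: "A \<in> \<U> i" "B \<in> \<U> i" "A \<noteq> B" "a \<in> A" "b \<in> B"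
      and "\<not> ereal r < graph_dist G a b"
    \<comment> \<open>Points of one colour at distance at most \<open>r\<close> are linked, so their
      components coincide.\<close>
    then have "near G n a b" unfolding n_def using assms(3) by (intro dist_imp_near) auto
    then have ab: "dS n a b" by (rule near_imp_reach[OF T(1)])
    obtain x y where xy: "x \<in> X i" "A = L i `` {x}" "y \<in> X i" "B = L i `` {y}"
      using AB by (auto simp: \<U>_def)
    then have xa: "(x, a) \<in> L i" and yb: "(y, b) \<in> L i" using AB by auto
    have "a \<in> X i" "b \<in> X i" using inX xa yb xy by blast+
    then have "(a, b) \<in> L i" using ab unfolding L_def by (simp add: dS.link_def r_into_rtrancl)
    then have "(x, y) \<in> L i" using xa yb symL[of i] transL[of i] by (meson symD transD)
    then have "A = B"
      unfolding xy using symL[of i] transL[of i] by (auto dest: symD transD)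
    then show False using AB by simp
  qed
  moreover have "bounded_family (graph_dist G) (real (colour_bound (Suc w) n) + 1)
      (\<Union>i\<in>{1..1+1}. \<U> i)"
    unfolding bounded_family_def ext_diameter_def
  proof (intro ballI SUP_least)
    fix A a b assume "A \<in> (\<Union>i\<in>{1..1+1}. \<U> i)" and a: "a \<in> A" and b: "b \<in> A"
    then obtain i x where x: "x \<in> X i" "A = L i `` {x}" by (auto simp: \<U>_def)
    then have "(a, b) \<in> L i" "a \<in> pverts G"
      using a b symL[of i] transL[of i] inX[of x a i] by (auto simp: X_def dest: symD transD)
    then have "dS (colour_bound (Suc w) n) a b"
      using dS.chain_boundedD[OF c] unfolding L_def X_def by blast
    then have "graph_dist G a b \<le> ereal (colour_bound (Suc w) n)"
      using near_imp_dist[OF reach_imp_R] \<open>a \<in> pverts G\<close> by blast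
    also have "\<dots> \<le> ereal (real (colour_bound (Suc w) n) + 1)" by simp
    finally show "graph_dist G a b \<le> ereal (real (colour_bound (Suc w) n) + 1)" .
  qed
  ultimately show ?thesis unfolding n_def by blast
qed

theorem theorem1p5:
  fixes w :: nat
  assumes "w \<ge> 1"
  shows "asdim {(pverts G, graph_dist G) | G :: 'a pair_pre_digraph.
           pair_graph G \<and> treewidth G \<le> int w} \<le> 1"
proof -
  \<comment> \<open>The summand 1 makes the control function positive.\<close>
  define D :: "real \<Rightarrow> real" where "D r = real (colour_bound (Suc w) (nat \<lceil>r\<rceil>)) + 1" for r
  have "control_function 1 D (pverts G) (graph_dist G)"
    if "pair_graph G" "treewidth G \<le> int w" for G :: "'a pair_pre_digraph"
    unfolding control_function_def D_def
  proof (intro conjI allI impI)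
    fix r :: real assume "r > 0"
    then show "\<exists>\<U> :: nat \<Rightarrow> 'a set set.
        \<Union>(\<Union>i\<in>{1..1+1}. \<U> i) = pverts G \<and>
        (\<forall>i\<in>{1..1+1}. disjoint_family_at_scale (graph_dist G) r (\<U> i)) \<and>
        bounded_family (graph_dist G) (real (colour_bound (Suc w) (nat \<lceil>r\<rceil>)) + 1)
          (\<Union>i\<in>{1..1+1}. \<U> i)"
      by (rule bounded_treewidth_cover[OF that])
  qed simp
  then have "\<forall>(X, d)\<in>{(pverts G, graph_dist G) | G :: 'a pair_pre_digraph.
      pair_graph G \<and> treewidth G \<le> int w}. control_function 1 D X d"
    by blast
  then show ?thesis unfolding asdim_def one_enat_def by (intro Inf_lower) blast
qed

end
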